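(* Assume the setting described in the context: the model is Bayes optimal, the priors are compactly supported, and the log-likelihoods $g_{ij}$ satisfy the uniform derivative bounds. Define, for $1\le i<j\le N$, $$\frac{1}{\Delta_{ij}}=\mathbb E_{P_{ij}(D\mid w=0)}\big[(\partial_w g_{ij}(D,0))^2\big]=\int (\partial_w g_{ij}(y,0))^2e^{g_{ij}(y,0)}\,dy .$$ Then $$\big|F_N(g)-F_N(\Delta)\big| = O(\kappa^3N^{-1/2})\qquad (N\to\infty),$$ where $F_N(g)$ is the free energy of the inhomogeneous vector spin model and $F_N(\Delta)$ is the free energy of the Gaussian spiked model with variance profile $\Delta=(\Delta_{ij})$.
   Context: Model. Fix $\kappa\ge1$ (independent of $N$). $P_0$ and $P_X$ are probability measures on $\mathbb R^\kappa$. For each $N$, $x^0=(x^0_1,\dots,x^0_N)$ has law $P_0^{\otimes N}$. For $i<j$, $P_{ij}(\cdot\mid w)$ is a family of probability laws indexed by real $w$ (allowed to depend on $i,j$ and $N$). Conditionally on $x^0$, the data $D_{ij}$ ($i<j$) are independent with $D_{ij}\sim P_{ij}(\cdot\mid x_i^0\cdot x_j^0/\sqrt N)$. For functions $g_{ij}(D,w)$ put $$Z_X^g(D)=\int\prod_{i<j}e^{g_{ij}(D_{ij},\,x_i\cdot x_j/\sqrt N)}\prod_{i\le N}dP_X(x_i),\qquad F_N(g)=\frac1N\,\mathbb E_D\Big(\ln Z_X^g(D)-\sum_{i<j}g_{ij}(D_{ij},0)\Big),$$ where $\mathbb E_D$ averages over $x^0$ and $D$. Bayes optimality: $P_0=P_X$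 and $g_{ij}(D,w)=\ln P_{ij}(D\mid w)$, where $P_{ij}(D\mid w)$ also denotes the density of $P_{ij}(\cdot\mid w)$ with respect to a fixed reference measure, written $dy$. Compact support: $P_0$ and $P_X$ are supported in $[-C,C]^\kappa$ for a finite $C$. In particular $|x_i\cdot x_j|/\sqrt N\le C^2\kappa/\sqrt N$. Regularity: $\|\partial_wg_{ij}(\cdot,0)\|$, $\|\partial_w^2g_{ij}(\cdot,0)\|$ and $\|\partial_w^3g_{ij}\|$ (supremum norms, over $D$, respectively over $D$ and $w$ in the domain, an interval containing all possible values of $w$) are bounded uniformly in $i<j\le N$ and $N$. Gaussian spiked model: with $(W_{ij})_{i<j}$ i.i.d. standard Gaussian, independent of $x^0$, $$H_N(x)=\sum_{i<j}\Big(\frac{W_{ij}}{\sqrt{\Delta_{ij}N}}(x_i\cdot x_j)+\frac{1}{\Delta_{ij}N}(x_i^0\cdot x_j^0)(x_i\cdot x_j)-\frac{1}{2\Delta_{ij}N}(x_i\cdot x_j)^2\Big),$$ $$F_N(\Delta)=\frac1N\,\mathbb E_{W,x^0}\ln\int e^{H_N(x)}\,dP_0^{\otimes N}(x).$$ *)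

theory Defs
  imports "HOL-Probability.Probability"
begin

text \<open>
  Every bound below has to be uniform in the dimension \<open>\<kappa>\<close>, so \<open>\<kappa>\<close> must be quantified inside a
  formula and cannot be a type. A vector of \<open>\<real>\<^sup>\<kappa>\<close> is therefore a function \<open>nat \<Rightarrow> real\<close> in the space
  of \<open>Pi\<^sub>M {..<\<kappa>} (\<lambda>_. borel)\<close>, and a configuration \<open>(x\<^sub>1, \<dots>, x\<^sub>N)\<close> a function in the space of the
  product over \<open>{1..N}\<close>. Disorder indexed by the pairs \<open>i < j\<close> is a function on \<open>pairs N\<close>.
\<close>

type_synonym vec = "nat \<Rightarrow> real"
type_synonym config = "nat \<Rightarrow> vec"
type_synonym 'd channel = "nat \<Rightarrow> nat \<Rightarrow> nat \<Rightarrow> real \<Rightarrow> 'd measure"  \<comment> \<open>\<open>P N i j w\<close>\<close>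
type_synonym 'd llh = "nat \<Rightarrow> nat \<Rightarrow> nat \<Rightarrow> 'd \<Rightarrow> real \<Rightarrow> real"  \<comment> \<open>\<open>g N i j D w\<close>\<close>

abbreviation vec_space :: "nat \<Rightarrow> vec measure" where
  "vec_space \<kappa> \<equiv> Pi\<^sub>M {..<\<kappa>} (\<lambda>_. borel)"

definition dot :: "nat \<Rightarrow> vec \<Rightarrow> vec \<Rightarrow> real" where
  "dot \<kappa> u v = (\<Sum>a<\<kappa>. u a * v a)"

definition pairs :: "nat \<Rightarrow> (nat \<times> nat) set" where
  "pairs N = {(i, j). 1 \<le> i \<and> i < j \<and> j \<le> N}"

abbreviation iid :: "nat \<Rightarrow> vec measure \<Rightarrow> config measure" where
  "iid N P0 \<equiv> Pi\<^sub>M {1..N} (\<lambda>_. P0)"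


subsection \<open>The inhomogeneous vector spin model\<close>

text \<open>
  \<open>\<mu>\<close> is the fixed reference measure on the data space. Joint measurability of \<open>g\<close> and measurability
  of \<open>w \<mapsto> P N i j w\<close> (a Markov kernel) are what the integrals defining the model presuppose.
\<close>

definition spin_model ::
  "nat \<Rightarrow> vec measure \<Rightarrow> vec measure \<Rightarrow> 'd measure \<Rightarrow> 'd channel \<Rightarrow> 'd llh \<Rightarrow> bool" where
  "spin_model \<kappa> P0 PX \<mu> P g \<longleftrightarrow>
     prob_space P0 \<and> sets P0 = sets (vec_space \<kappa>) \<and>
     prob_space PX \<and> sets PX = sets (vec_space \<kappa>) \<and>
     (\<forall>N\<ge>1. \<forall>(i, j)\<in>pairs N.
        P N i j \<in> borel \<rightarrow>\<^sub>M prob_algebra \<mu> \<and>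
        (\<lambda>(y, w). g N i j y w) \<in> borel_measurable (\<mu> \<Otimes>\<^sub>M borel))"

definition data_law :: "nat \<Rightarrow> 'd channel \<Rightarrow> nat \<Rightarrow> config \<Rightarrow> (nat \<times> nat \<Rightarrow> 'd) measure" where
  "data_law \<kappa> P N x0 = Pi\<^sub>M (pairs N) (\<lambda>(i, j). P N i j (dot \<kappa> (x0 i) (x0 j) / sqrt (real N)))"

definition partition_fun ::
  "nat \<Rightarrow> vec measure \<Rightarrow> 'd llh \<Rightarrow> nat \<Rightarrow> (nat \<times> nat \<Rightarrow> 'd) \<Rightarrow> real" where
  "partition_fun \<kappa> PX g N D =
     (\<integral>x. (\<Prod>(i, j)\<in>pairs N. exp (g N i j (D (i, j)) (dot \<kappa> (x i) (x j) / sqrt (real N)))) \<partial>iid N PX)"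

definition free_energy ::
  "nat \<Rightarrow> vec measure \<Rightarrow> vec measure \<Rightarrow> 'd channel \<Rightarrow> 'd llh \<Rightarrow> nat \<Rightarrow> real" where
  "free_energy \<kappa> P0 PX P g N =
     1 / real N *
     (\<integral>x0. (\<integral>D. ln (partition_fun \<kappa> PX g N D) - (\<Sum>(i, j)\<in>pairs N. g N i j (D (i, j)) 0)
            \<partial>data_law \<kappa> P N x0) \<partial>iid N P0)"


subsection \<open>Hypotheses\<close>

text \<open>
  \<open>S N\<close> is the domain of the variable \<open>w\<close> at size \<open>N\<close>. Nothing but measurability is required of
  \<open>g\<close> and \<open>P\<close> outside of it.
\<close>

definition admissible_domain :: "nat \<Rightarrow> real \<Rightarrow> (nat \<Rightarrow> real set) \<Rightarrow> bool" where
  "admissible_domain \<kappa> C S \<longleftrightarrow>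
     (\<forall>N\<ge>1. is_interval (S N) \<and>
        {- (C\<^sup>2 * real \<kappa> / sqrt (real N)) .. C\<^sup>2 * real \<kappa> / sqrt (real N)} \<subseteq> S N)"

definition bayes_optimal ::
  "vec measure \<Rightarrow> vec measure \<Rightarrow> 'd measure \<Rightarrow> (nat \<Rightarrow> real set) \<Rightarrow> 'd channel \<Rightarrow> 'd llh \<Rightarrow> bool" where
  "bayes_optimal P0 PX \<mu> S P g \<longleftrightarrow>
     P0 = PX \<and>
     (\<forall>N\<ge>1. \<forall>(i, j)\<in>pairs N. \<forall>w\<in>S N.
        P N i j w = density \<mu> (\<lambda>y. ennreal (exp (g N i j y w))))"

definition supported_in_cube :: "nat \<Rightarrow> real \<Rightarrow> vec measure \<Rightarrow> bool" where
  "supported_in_cube \<kappa> C Q \<longleftrightarrow> (AE x in Q. \<forall>a<\<kappa>. x a \<in> {- C .. C})"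

text \<open>
  \<open>g1\<close>, \<open>g2\<close>, \<open>g3\<close> are the first three \<open>w\<close>-derivatives on the domain (one-sided at an endpoint that
  belongs to it).
\<close>

definition regular_llh :: "real \<Rightarrow> 'd measure \<Rightarrow> (nat \<Rightarrow> real set) \<Rightarrow> 'd llh \<Rightarrow> bool" where
  "regular_llh B \<mu> S g \<longleftrightarrow>
     (\<forall>N\<ge>1. \<forall>(i, j)\<in>pairs N. \<forall>y\<in>space \<mu>. \<exists>g1 g2 g3 :: real \<Rightarrow> real.
        (\<forall>w\<in>S N.
           (g N i j y has_real_derivative g1 w) (at w within S N) \<and>
           (g1 has_real_derivative g2 w) (at w within S N) \<and>
           (g2 has_real_derivative g3 w) (at w within S N) \<and>
           \<bar>g3 w\<bar> \<le> B) \<and>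
        \<bar>g1 0\<bar> \<le> B \<and> \<bar>g2 0\<bar> \<le> B)"

text \<open>
  If the expectation vanishes (\<open>\<Delta>\<^sub>i\<^sub>j = \<infinity>\<close> on paper), the equation forces \<open>\<Delta> N i j = 0\<close>. Since
  division by zero yields \<open>0\<close>, every term of \<open>gauss_hamiltonian\<close> for that pair is then \<open>0\<close>, as it
  should be.
\<close>

definition variance_profile ::
  "'d channel \<Rightarrow> 'd llh \<Rightarrow> (nat \<Rightarrow> nat \<Rightarrow> nat \<Rightarrow> real) \<Rightarrow> bool" where
  "variance_profile P g \<Delta> \<longleftrightarrow>
     (\<forall>N\<ge>1. \<forall>(i, j)\<in>pairs N.
        1 / \<Delta> N i j = (\<integral>y. (deriv (g N i j y) 0)\<^sup>2 \<partial>P N i j 0))"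


subsection \<open>The Gaussian spiked model\<close>

definition gauss_hamiltonian ::
  "nat \<Rightarrow> (nat \<Rightarrow> nat \<Rightarrow> nat \<Rightarrow> real) \<Rightarrow> nat \<Rightarrow> (nat \<times> nat \<Rightarrow> real) \<Rightarrow> config \<Rightarrow> config \<Rightarrow> real" where
  "gauss_hamiltonian \<kappa> \<Delta> N W x0 x =
     (\<Sum>(i, j)\<in>pairs N.
        W (i, j) / sqrt (\<Delta> N i j * real N) * dot \<kappa> (x i) (x j)
        + 1 / (\<Delta> N i j * real N) * dot \<kappa> (x0 i) (x0 j) * dot \<kappa> (x i) (x j)
        - 1 / (2 * \<Delta> N i j * real N) * (dot \<kappa> (x i) (x j))\<^sup>2)"

definition gauss_free_energy ::
  "nat \<Rightarrow> vec measure \<Rightarrow> (nat \<Rightarrow> nat \<Rightarrow> nat \<Rightarrow> real) \<Rightarrow> nat \<Rightarrow> real" where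
  "gauss_free_energy \<kappa> P0 \<Delta> N =
     1 / real N *
     (\<integral>(W, x0). ln (\<integral>x. exp (gauss_hamiltonian \<kappa> \<Delta> N W x0 x) \<partial>iid N P0)
        \<partial>(Pi\<^sub>M (pairs N) (\<lambda>_. std_normal_distribution) \<Otimes>\<^sub>M iid N P0))"

end

theory Submission
  imports Defs
begin

text \<open>
  Lindeberg's exchange method, one pair at a time. Condition on \<open>x\<^sup>0\<close> and on the data of all pairs but
  one, and let \<open>m\<close> be the Gibbs mean of the overlap \<open>w\<close> of that pair under the remaining Hamiltonian. A third order
  expansion of \<open>ln \<langle>exp (g(D, w) - g(D, 0))\<rangle>\<close>, averaged over \<open>D\<close> with true overlap \<open>w\<^sub>0\<close>, yields
  \<open>(w\<^sub>0 m - m\<^sup>2 / 2) / \<Delta> + O(c\<^sup>3)\<close>, where \<open>c = C\<^sup>2 \<kappa> / sqrt N\<close> bounds all overlaps: normalisation of the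
  likelihood gives \<open>E[\<partial>g] = 0\<close> and \<open>E[\<partial>\<^sup>2g + (\<partial>g)\<^sup>2] = 0\<close> at \<open>w = 0\<close>, so that only the Fisher information
  \<open>1 / \<Delta>\<close> survives. The Gaussian channel with the same Fisher information has the same expansion, hence
  exchanging one channel costs \<open>O(c\<^sup>3)\<close>, and exchanging all of the at most \<open>N\<^sup>2\<close> channels costs
  \<open>O(N\<^sup>2 c\<^sup>3)\<close>. Where \<open>c\<close> is not small, the expansion is replaced by the trivial bound \<open>O(c + c\<^sup>2 + c\<^sup>3)\<close>, which
  makes the error uniform in \<open>\<kappa>\<close>.
\<close>


text \<open>The Gibbs measure changes with every exchange, so two channels are compared under an
  arbitrary probability measure on the configurations; no symmetry between \<open>x0\<close> and a
  Gibbs sample is invoked. This works because the second moment of \<open>w\<close>, which the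
  cumulant expansion produces next to the mean, has a coefficient whose average over the data is of
  order \<open>c\<close> for either channel. The leading part thus depends only on the Gibbs mean,
  the true overlap and the Fisher information. The data are drawn at the true overlap and not at 0.
  Reweighting by the likelihood ratio moves the mean score from 0 to \<open>w0 / \<Delta>\<close> up
  to order \<open>c\<^sup>2\<close>: this is the signal term. Two obstacles shape the rest. Gaussian
  noise is unbounded, so errors are random and only their means are bounded; integrability travels
  along as a domination condition. And the derivatives of \<open>g\<close> are given separately for
  each data point, so their measurability in the data is recovered from difference quotients. The
  powers balance as \<open>(1/N) * N^2 * c^3 = C^6 * \<kappa>^3 * N^(-1/2)\<close>.\<close>

section \<open>Second order expansion of a log-partition function\<close>

text \<open>Three mean value estimates, for \<open>f2\<close>, \<open>f1\<close> and
  \<open>f\<close> in turn, each gaining a factor \<open>\<bar>w\<bar>\<close>. They need only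
  derivatives relative to the interval, so 0 or \<open>w\<close> may be an endpoint of
  \<open>S\<close>. The factor 1/6 of Taylor's theorem is given away.\<close>

lemma second_order_taylor_bound:
  fixes f f1 f2 f3 :: "real \<Rightarrow> real"
  assumes S: "is_interval S" "0 \<in> S" "w \<in> S"
    and f: "\<And>z. z \<in> S \<Longrightarrow> (f has_real_derivative f1 z) (at z within S)"
    and f1: "\<And>z. z \<in> S \<Longrightarrow> (f1 has_real_derivative f2 z) (at z within S)"
    and f2: "\<And>z. z \<in> S \<Longrightarrow> (f2 has_real_derivative f3 z) (at z within S)"
    and f3: "\<And>z. z \<in> S \<Longrightarrow> \<bar>f3 z\<bar> \<le> B"
  shows "\<bar>f w - f 0 - f1 0 * w - f2 0 * w\<^sup>2 / 2\<bar> \<le> B * \<bar>w\<bar> ^ 3"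
proof -
  define J where "J = S \<inter> {- \<bar>w\<bar>..\<bar>w\<bar>}"
  have B: "0 \<le> B" using f3[OF S(2)] by linarith
  have J: "convex J" "0 \<in> J" "w \<in> J" and JS: "J \<subseteq> S"
    using S by (auto simp: J_def intro!: is_interval_convex is_interval_Int is_interval_cc)
  have Jw: "\<bar>z\<bar> \<le> \<bar>w\<bar>" if "z \<in> J" for z using that by (auto simp: J_def)
  note sub = has_field_derivative_subset[OF _ JS]
  have b2: "\<bar>f2 z - f2 0\<bar> \<le> B * \<bar>w\<bar>" if z: "z \<in> J" for z
  proof -
    have "norm (f2 z - f2 0) \<le> B * norm (z - 0)"
      by (rule field_differentiable_bound[OF J(1), of _ f3])
        (use f2 f3 sub JS z J in auto)
    also have "\<dots> \<le> B * \<bar>w\<bar>" using Jw[OF z] B by (auto intro: mult_left_mono)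
    finally show ?thesis by simp
  qed
  have b1: "\<bar>f1 z - f1 0 - f2 0 * z\<bar> \<le> B * \<bar>w\<bar> * \<bar>w\<bar>" if z: "z \<in> J" for z
  proof -
    have "norm ((f1 z - f2 0 * z) - (f1 0 - f2 0 * 0)) \<le> B * \<bar>w\<bar> * norm (z - 0)"
      by (rule field_differentiable_bound[OF J(1), of _ "\<lambda>z. f2 z - f2 0"])
        (use f1 b2 sub JS z J in \<open>auto intro!: derivative_eq_intros\<close>)
    also have "\<dots> \<le> B * \<bar>w\<bar> * \<bar>w\<bar>" using Jw[OF z] B by (auto intro: mult_left_mono)
    finally show ?thesis by (simp add: algebra_simps)
  qed
  have "norm ((f w - f1 0 * w - f2 0 * w\<^sup>2 / 2) - (f 0 - f1 0 * 0 - f2 0 * 0\<^sup>2 / 2))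
      \<le> B * \<bar>w\<bar> * \<bar>w\<bar> * norm (w - 0)"
    by (rule field_differentiable_bound[OF J(1), of _ "\<lambda>z. f1 z - f1 0 - f2 0 * z"])
      (use f b1 sub JS J in \<open>auto intro!: derivative_eq_intros\<close>)
  then show ?thesis by (simp add: algebra_simps power3_eq_cube)
qed

lemma exp_taylor_bound:
  fixes v :: real
  assumes "\<bar>v\<bar> \<le> 1"
  shows "\<bar>exp v - 1 - v - v\<^sup>2 / 2\<bar> \<le> 3 * \<bar>v\<bar> ^ 3"
proof -
  have "exp z \<le> 3" if "z \<in> {-1..1}" for z :: real
    using that exp_le by (auto intro: order_trans[of _ "exp 1"])
  then show ?thesis
    using second_order_taylor_bound[of "{-1..1}" v exp exp exp exp 3] assms
    by (auto simp: is_interval_cc abs_le_iff intro!: DERIV_exp[THEN has_field_derivative_at_within])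
qed

lemma ln_taylor_bound:
  fixes y :: real
  assumes "\<bar>y\<bar> \<le> 1 / 2"
  shows "\<bar>ln (1 + y) - y + y\<^sup>2 / 2\<bar> \<le> 16 * \<bar>y\<bar> ^ 3"
proof -
  have pos: "0 < 1 + z" if "z \<in> {-1/2..1/2}" for z :: real using that by auto
  \<comment> \<open>The third derivative of \<open>ln (1 + z)\<close> is largest at the left end
    \<open>z = - 1 / 2\<close>, where it equals 16.\<close>
  have b: "\<bar>2 / (1 + z) ^ 3\<bar> \<le> 16" if z: "z \<in> {-1/2..1/2}" for z :: real
  proof -
    have "(1 / 2 :: real) ^ 3 \<le> (1 + z) ^ 3" using z by (intro power_mono) auto
    then show ?thesis using pos[OF z] by (simp add: field_simps power3_eq_cube)
  qed
  have d1: "((\<lambda>y. ln (1 + y)) has_real_derivative 1 / (1 + z)) (at z within {-1/2..1/2})"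
    and d2: "((\<lambda>y. 1 / (1 + y)) has_real_derivative - (1 / (1 + z)\<^sup>2)) (at z within {-1/2..1/2})"
    and d3: "((\<lambda>y. - (1 / (1 + y)\<^sup>2)) has_real_derivative 2 / (1 + z) ^ 3) (at z within {-1/2..1/2})"
    if z: "z \<in> {-1/2..1/2}" for z :: real
    using pos[OF z] by (auto intro!: derivative_eq_intros
      simp: power2_eq_square power3_eq_cube divide_simps)
  have y: "0 \<in> {-1/2..1/2::real}" "y \<in> {-1/2..1/2}" using assms by auto
  show ?thesis
    using second_order_taylor_bound[OF is_interval_cc y d1 d2 d3 b] by simp
qed

lemma (in prob_space) log_exp_moment_bound:
  fixes v :: "'a \<Rightarrow> real"
  assumes [measurable]: "v \<in> borel_measurable M" and vs: "\<And>x. x \<in> space M \<Longrightarrow> \<bar>v x\<bar> \<le> s"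
  shows "integrable M (\<lambda>x. exp (v x))" "exp (- s) \<le> (\<integral>x. exp (v x) \<partial>M)"
    "\<bar>ln (\<integral>x. exp (v x) \<partial>M)\<bar> \<le> s"
proof -
  show i: "integrable M (\<lambda>x. exp (v x))"
    by (rule integrable_const_bound[where B="exp s"]) (use vs in \<open>auto simp: abs_le_iff\<close>)
  have l: "(\<integral>x. exp (- s) \<partial>M) \<le> (\<integral>x. exp (v x) \<partial>M)"
    by (rule integral_mono[OF _ i]) (use vs in \<open>auto simp: abs_le_iff minus_le_iff\<close>)
  then show l: "exp (- s) \<le> (\<integral>x. exp (v x) \<partial>M)" by (simp add: prob_space)
  have "(\<integral>x. exp (v x) \<partial>M) \<le> (\<integral>x. exp s \<partial>M)"
    by (rule integral_mono[OF i]) (use vs in \<open>auto simp: abs_le_iff\<close>)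
  then have u: "(\<integral>x. exp (v x) \<partial>M) \<le> exp s" by (simp add: prob_space)
  have p: "0 < (\<integral>x. exp (v x) \<partial>M)" using l exp_gt_zero[of "- s"] by linarith
  have "ln (\<integral>x. exp (v x) \<partial>M) \<le> s" using u p by (metis ln_exp ln_le_cancel_iff exp_gt_zero)
  moreover have "- s \<le> ln (\<integral>x. exp (v x) \<partial>M)"
    using l p by (metis ln_exp ln_le_cancel_iff exp_gt_zero)
  ultimately show "\<bar>ln (\<integral>x. exp (v x) \<partial>M)\<bar> \<le> s" by linarith
qed

lemma (in prob_space) abs_expectation_le:
  fixes v :: "'a \<Rightarrow> real"
  assumes "v \<in> borel_measurable M" "\<And>x. x \<in> space M \<Longrightarrow> \<bar>v x\<bar> \<le> s"
  shows "integrable M v" "\<bar>expectation v\<bar> \<le> s"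
proof -
  show i: "integrable M v"
    by (rule integrable_const_bound[where B=s]) (use assms in auto)
  have "\<bar>expectation v\<bar> \<le> (\<integral>x. \<bar>v x\<bar> \<partial>M)" by (rule integral_abs_bound)
  also have "\<dots> \<le> (\<integral>x. s \<partial>M)" by (rule integral_mono) (use i assms in auto)
  finally show "\<bar>expectation v\<bar> \<le> s" by (simp add: prob_space)
qed

text \<open>No smallness of \<open>s\<close> is assumed: Taylor bounds for exp and then for ln
  settle small \<open>s\<close>, and crude bounds on each term settle the rest.\<close>

lemma (in prob_space) second_cumulant_expansion:
  fixes v :: "'a \<Rightarrow> real"
  assumes v[measurable]: "v \<in> borel_measurable M" and vs: "\<And>x. x \<in> space M \<Longrightarrow> \<bar>v x\<bar> \<le> s"
  shows "\<bar>ln (\<integral>x. exp (v x) \<partial>M) - (expectation v + expectation (\<lambda>x. (v x)\<^sup>2) / 2 - (expectation v)\<^sup>2 / 2)\<bar>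
    \<le> 50 * s ^ 3"
proof -
  define m1 m2 y where "m1 = expectation v" "m2 = expectation (\<lambda>x. (v x)\<^sup>2)"
    "y = (\<integral>x. exp (v x) \<partial>M) - 1"
  obtain x where "x \<in> space M" using not_empty by blast
  then have s: "0 \<le> s" using vs[of x] by linarith
  have v2: "\<bar>(v x)\<^sup>2\<bar> \<le> s\<^sup>2" if "x \<in> space M" for x
    using vs[OF that] by (simp add: abs_le_square_iff[symmetric])
  have m1: "\<bar>m1\<bar> \<le> s" and m2: "\<bar>m2\<bar> \<le> s\<^sup>2"
    using abs_expectation_le(2)[OF v vs] abs_expectation_le(2)[OF _ v2] by (auto simp: m1_m2_y_def)
  have m1': "\<bar>m1\<^sup>2\<bar> \<le> s\<^sup>2" using m1 by (simp add: abs_le_square_iff[symmetric])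
  have int: "integrable M v" "integrable M (\<lambda>x. (v x)\<^sup>2)" "integrable M (\<lambda>x. exp (v x))"
    by (rule abs_expectation_le(1)[OF v vs] abs_expectation_le(1)[OF _ v2]
      log_exp_moment_bound(1)[OF v vs]; measurable)+
  show ?thesis
  proof (cases "s \<le> 1 / 4")
    \<comment> \<open>Now \<open>s\<close> and \<open>s\<^sup>2\<close> are at most
      \<open>16 * s ^ 3\<close> and \<open>4 * s ^ 3\<close>, and the four terms add up to at most
      \<open>36 * s ^ 3\<close>.\<close>
    case False
    then have "s * (1 / 4)\<^sup>2 \<le> s * s\<^sup>2" "s\<^sup>2 * (1 / 4) \<le> s\<^sup>2 * s" using s
      by (auto intro!: mult_left_mono power_mono)
    then have 1: "s \<le> 16 * s ^ 3" "s\<^sup>2 \<le> 4 * s ^ 3" by (simp_all add: power3_eq_cube power2_eq_square)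
    have "\<bar>ln (\<integral>x. exp (v x) \<partial>M)\<bar> \<le> s" by (rule log_exp_moment_bound[OF v vs])
    with 1 m1 m2 m1' show ?thesis
      unfolding m1_m2_y_def(1,2)[symmetric] by linarith
  next
    case True
    have y: "\<bar>y - m1 - m2 / 2\<bar> \<le> 3 * s ^ 3"
    proof -
      have "y - m1 - m2 / 2 = expectation (\<lambda>x. exp (v x) - 1 - v x - (v x)\<^sup>2 / 2)"
        unfolding m1_m2_y_def using int by (simp add: prob_space)
      also have "\<bar>\<dots>\<bar> \<le> 3 * s ^ 3"
      proof (rule abs_expectation_le)
        fix x assume "x \<in> space M"
        then have 1: "\<bar>v x\<bar> \<le> s" by (rule vs)
        then have "\<bar>exp (v x) - 1 - v x - (v x)\<^sup>2 / 2\<bar> \<le> 3 * \<bar>v x\<bar> ^ 3"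
          using True by (intro exp_taylor_bound) auto
        also have "\<dots> \<le> 3 * s ^ 3" using 1 by (intro mult_left_mono power_mono) auto
        finally show "\<bar>exp (v x) - 1 - v x - (v x)\<^sup>2 / 2\<bar> \<le> 3 * s ^ 3" .
      qed simp
      finally show ?thesis .
    qed
    have ss: "s\<^sup>2 \<le> s / 4" "s ^ 3 \<le> s\<^sup>2 / 4"
      using mult_left_mono[OF True s] mult_left_mono[OF True, of "s * s"] s
      by (auto simp: power2_eq_square power3_eq_cube)
    \<comment> \<open>Each surplus power of \<open>s\<close> is worth a factor 1/4. The resulting
      \<open>\<bar>y\<bar> \<le> 1 / 3\<close> stays within the range of the bound for ln.\<close>
    have ym: "\<bar>y - m1\<bar> \<le> 5 / 4 * s\<^sup>2" and ys: "\<bar>y\<bar> \<le> 4 / 3 * s" and yp: "\<bar>y + m1\<bar> \<le> 7 / 3 * s"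
      using y m1 m2 ss s by linarith+
    have "\<bar>y\<^sup>2 - m1\<^sup>2\<bar> = \<bar>y - m1\<bar> * \<bar>y + m1\<bar>"
      by (simp add: abs_mult[symmetric] power2_eq_square algebra_simps)
    also have "\<dots> \<le> (5 / 4 * s\<^sup>2) * (7 / 3 * s)" using ym yp by (intro mult_mono) auto
    finally have sq: "\<bar>y\<^sup>2 - m1\<^sup>2\<bar> \<le> 35 / 12 * s ^ 3" by (simp add: power2_eq_square power3_eq_cube)
    have "\<bar>ln (1 + y) - y + y\<^sup>2 / 2\<bar> \<le> 16 * \<bar>y\<bar> ^ 3"
      using ys True by (intro ln_taylor_bound) auto
    also have "\<dots> \<le> 16 * (4 / 3 * s) ^ 3" using ys by (intro mult_left_mono power_mono) auto
    finally have "\<bar>ln (1 + y) - y + y\<^sup>2 / 2\<bar> \<le> 1024 / 27 * s ^ 3" by (simp add: power3_eq_cube)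
    moreover have "0 \<le> s ^ 3" using s by simp
    moreover have "ln (1 + y) = ln (\<integral>x. exp (v x) \<partial>M)" by (simp add: m1_m2_y_def)
    ultimately show ?thesis using y sq unfolding m1_m2_y_def(1,2)[symmetric] by linarith
  qed
qed

text \<open>In the application the data are fixed, \<open>v\<close> is the increment of the
  channel's Hamiltonian and \<open>\<alpha>\<close>, \<open>\<beta>\<close> are its first two
  derivatives at overlap 0. \<open>T\<close> is kept apart from \<open>K\<close> because the score
  of the Gaussian channel is unbounded in the noise; the error is polynomial in \<open>T\<close>, so
  that it can be averaged. \<open>\<beta> + \<alpha>\<^sup>2\<close> is kept together because its
  average over the data nearly vanishes.\<close>

lemma (in prob_space) quadratic_log_expansion:
  fixes v w :: "'a \<Rightarrow> real"
  assumes w[measurable]: "w \<in> borel_measurable M" and wc: "\<And>x. x \<in> space M \<Longrightarrow> \<bar>w x\<bar> \<le> c"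
    and v[measurable]: "v \<in> borel_measurable M"
    and vw: "\<And>x. x \<in> space M \<Longrightarrow> \<bar>v x - \<alpha> * w x - \<beta> * (w x)\<^sup>2 / 2\<bar> \<le> K * c ^ 3"
    and c: "c \<le> 1" and K: "1 \<le> K" and T: "\<bar>\<alpha>\<bar> \<le> T" and \<beta>: "\<bar>\<beta>\<bar> \<le> K"
  shows "\<bar>ln (\<integral>x. exp (v x) \<partial>M) - (\<alpha> * expectation w + (\<beta> + \<alpha>\<^sup>2) * expectation (\<lambda>x. (w x)\<^sup>2) / 2
      - \<alpha>\<^sup>2 * (expectation w)\<^sup>2 / 2)\<bar> \<le> 55 * c ^ 3 * (T + 2 * K) ^ 3"
proof -
  define \<tau> where "\<tau> = T + 2 * K"
  define m q where "m = expectation w" "q = expectation (\<lambda>x. (w x)\<^sup>2)"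
  obtain x where "x \<in> space M" using not_empty by blast
  then have c0: "0 \<le> c" using wc[of x] by linarith
  have cc: "c ^ 3 \<le> c\<^sup>2" "c\<^sup>2 \<le> c"
    using c c0 by (auto simp: power2_eq_square power3_eq_cube mult_left_le mult_left_le_one_le)
  have w2: "\<bar>(w x)\<^sup>2\<bar> \<le> c\<^sup>2" if "x \<in> space M" for x
    using wc[OF that] by (simp add: abs_le_square_iff[symmetric])
  have Kc: "K * c ^ 3 \<le> K * c\<^sup>2" "K * c\<^sup>2 \<le> K * c" using cc K by (auto intro: mult_left_mono)
  have aw: "\<bar>\<alpha> * w x\<bar> \<le> T * c" if "x \<in> space M" for x
    unfolding abs_mult using wc[OF that] T by (intro mult_mono) auto
  have bw: "\<bar>\<beta> * (w x)\<^sup>2\<bar> \<le> K * c\<^sup>2" if "x \<in> space M" for x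
    unfolding abs_mult using w2[OF that] \<beta> by (intro mult_mono) auto
  have r: "\<bar>v x - \<alpha> * w x\<bar> \<le> 3 / 2 * (K * c\<^sup>2)" if "x \<in> space M" for x
    using vw[OF that] bw[OF that] Kc by linarith
  have vs: "\<bar>v x\<bar> \<le> \<tau> * c" if "x \<in> space M" for x
  proof -
    have "\<bar>v x\<bar> \<le> T * c + 3 / 2 * (K * c)" using aw[OF that] r[OF that] Kc by linarith
    also have "\<dots> \<le> \<tau> * c" using K c0 by (simp add: \<tau>_def algebra_simps)
    finally show ?thesis .
  qed
  have T\<tau>: "T * c \<le> \<tau> * c" using K c0 by (intro mult_right_mono) (auto simp: \<tau>_def)
  have v2: "\<bar>(v x)\<^sup>2\<bar> \<le> (\<tau> * c)\<^sup>2" if "x \<in> space M" for x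
    using vs[OF that] by (simp add: abs_le_square_iff[symmetric])
  have int[simp]: "integrable M v" "integrable M w" "integrable M (\<lambda>x. (w x)\<^sup>2)" "integrable M (\<lambda>x. (v x)\<^sup>2)"
    by (rule abs_expectation_le(1)[OF v vs] abs_expectation_le(1)[OF w wc]
      abs_expectation_le(1)[OF _ w2] abs_expectation_le(1)[OF _ v2]; measurable)+
  have e1: "\<bar>expectation v - \<alpha> * m - \<beta> * q / 2\<bar> \<le> K * c ^ 3"
  proof -
    have "expectation v - \<alpha> * m - \<beta> * q / 2 = expectation (\<lambda>x. v x - \<alpha> * w x - \<beta> * (w x)\<^sup>2 / 2)"
      by (simp add: m_q_def)
    also have "\<bar>\<dots>\<bar> \<le> K * c ^ 3" by (rule abs_expectation_le(2)[OF _ vw]) measurable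
    finally show ?thesis .
  qed
  have prod: "3 / 2 * (K * c\<^sup>2) * (2 * (\<tau> * c)) = 3 * K * \<tau> * c ^ 3"
    by (simp add: power2_eq_square power3_eq_cube)
  have e2: "\<bar>expectation (\<lambda>x. (v x)\<^sup>2) - \<alpha>\<^sup>2 * q\<bar> \<le> 3 * K * \<tau> * c ^ 3"
  proof -
    have "expectation (\<lambda>x. (v x)\<^sup>2) - \<alpha>\<^sup>2 * q = expectation (\<lambda>x. (v x)\<^sup>2 - \<alpha>\<^sup>2 * (w x)\<^sup>2)"
      by (simp add: m_q_def)
    also have "\<bar>\<dots>\<bar> \<le> 3 * K * \<tau> * c ^ 3"
    proof (rule abs_expectation_le(2))
      fix x assume x: "x \<in> space M"
      have "\<bar>(v x)\<^sup>2 - \<alpha>\<^sup>2 * (w x)\<^sup>2\<bar> = \<bar>v x - \<alpha> * w x\<bar> * \<bar>v x + \<alpha> * w x\<bar>"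
        by (simp add: abs_mult[symmetric] power2_eq_square algebra_simps)
      also have "\<dots> \<le> 3 / 2 * (K * c\<^sup>2) * (2 * (\<tau> * c))"
        using K vs[OF x] aw[OF x] T\<tau> by (intro mult_mono r[OF x]) auto
      finally show "\<bar>(v x)\<^sup>2 - \<alpha>\<^sup>2 * (w x)\<^sup>2\<bar> \<le> 3 * K * \<tau> * c ^ 3" unfolding prod .
    qed simp
    finally show ?thesis .
  qed
  have e3: "\<bar>(expectation v)\<^sup>2 - \<alpha>\<^sup>2 * m\<^sup>2\<bar> \<le> 3 * K * \<tau> * c ^ 3"
  proof -
    have 1: "\<bar>expectation (\<lambda>x. v x - \<alpha> * w x)\<bar> \<le> 3 / 2 * (K * c\<^sup>2)"
      "\<bar>expectation v\<bar> \<le> \<tau> * c" "\<bar>expectation (\<lambda>x. \<alpha> * w x)\<bar> \<le> T * c"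
      by (rule abs_expectation_le(2)[OF _ r] abs_expectation_le(2)[OF v vs] abs_expectation_le(2)[OF _ aw];
        measurable)+
    then have "\<bar>expectation v - \<alpha> * m\<bar> \<le> 3 / 2 * (K * c\<^sup>2)" "\<bar>expectation v + \<alpha> * m\<bar> \<le> 2 * (\<tau> * c)"
      using T\<tau> by (simp_all add: m_q_def)
    then have "\<bar>expectation v - \<alpha> * m\<bar> * \<bar>expectation v + \<alpha> * m\<bar> \<le> 3 / 2 * (K * c\<^sup>2) * (2 * (\<tau> * c))"
      using K by (intro mult_mono) auto
    moreover have "\<bar>(expectation v)\<^sup>2 - \<alpha>\<^sup>2 * m\<^sup>2\<bar> = \<bar>expectation v - \<alpha> * m\<bar> * \<bar>expectation v + \<alpha> * m\<bar>"
      by (simp add: abs_mult[symmetric] power2_eq_square algebra_simps)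
    ultimately show ?thesis unfolding prod by linarith
  qed
  have "\<bar>ln (\<integral>x. exp (v x) \<partial>M) - (expectation v + expectation (\<lambda>x. (v x)\<^sup>2) / 2 - (expectation v)\<^sup>2 / 2)\<bar>
    \<le> 50 * (\<tau> * c) ^ 3" by (rule second_cumulant_expansion[OF v vs])
  then have "\<bar>ln (\<integral>x. exp (v x) \<partial>M) - (\<alpha> * m + (\<beta> + \<alpha>\<^sup>2) * q / 2 - \<alpha>\<^sup>2 * m\<^sup>2 / 2)\<bar>
    \<le> 50 * (\<tau> ^ 3 * c ^ 3) + K * c ^ 3 + 3 * K * \<tau> * c ^ 3"
    using e1 e2 e3 unfolding power_mult_distrib distrib_right add_divide_distrib by linarith
  also have "\<dots> = c ^ 3 * (50 * \<tau> ^ 3 + K + 3 * K * \<tau>)" by (simp add: algebra_simps)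
  also have "\<dots> \<le> c ^ 3 * (55 * \<tau> ^ 3)"
  proof (rule mult_left_mono)
    \<comment> \<open>The mixed terms are absorbed by \<open>\<tau> ^ 3\<close>; the coefficients
      add up to \<open>50 + 1 + 3\<close>, below 55.\<close>
    have \<tau>1: "2 * K \<le> \<tau>" "1 \<le> \<tau>" using T K by (auto simp: \<tau>_def)
    have "K \<le> \<tau> ^ 3" using \<tau>1 power_increasing[of 1 3 \<tau>] K by simp
    moreover have "K * \<tau> \<le> \<tau> ^ 3"
    proof -
      have "K * \<tau> \<le> \<tau> * \<tau>" using \<tau>1 K by (intro mult_right_mono) auto
      also have "\<dots> \<le> \<tau> ^ 3" using \<tau>1 power_increasing[of 2 3 \<tau>] by (simp add: power2_eq_square)
      finally show ?thesis .
    qed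
    moreover have "0 \<le> \<tau> ^ 3" using \<tau>1 by simp
    ultimately show "50 * \<tau> ^ 3 + K + 3 * K * \<tau> \<le> 55 * \<tau> ^ 3" by linarith
  qed (use c0 in simp)
  finally show ?thesis by (simp add: m_q_def \<tau>_def mult.assoc)
qed

section \<open>Exchange of channels\<close>

text \<open>A channel is a noise law \<open>R\<close> with a random Hamiltonian \<open>f\<close>. A
  majorant depending on the noise alone provides what fixed noise needs (a bounded Hamiltonian,
  hence a positive partition function) and what averaging needs (it also bounds the logarithm). A
  constant majorant would exclude Gaussian noise.\<close>

definition dominated_channel :: "'a measure \<Rightarrow> 'e measure \<Rightarrow> ('e \<Rightarrow> 'a \<Rightarrow> real) \<Rightarrow> bool" where
  "dominated_channel M R f \<longleftrightarrow> prob_space R \<and> (\<lambda>(d, x). f d x) \<in> borel_measurable (R \<Otimes>\<^sub>M M) \<and>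
     (\<exists>F. integrable R F \<and> (\<forall>d\<in>space R. \<forall>x\<in>space M. \<bar>f d x\<bar> \<le> F d))"

lemma dominated_channelI:
  assumes "prob_space R" "(\<lambda>(d, x). f d x) \<in> borel_measurable (R \<Otimes>\<^sub>M M)" "integrable R F"
    "\<And>d x. d \<in> space R \<Longrightarrow> x \<in> space M \<Longrightarrow> \<bar>f d x\<bar> \<le> F d"
  shows "dominated_channel M R f"
  unfolding dominated_channel_def using assms by (intro conjI exI[of _ F] ballI)

lemma dominated_channelD:
  assumes "dominated_channel M R f"
  shows "prob_space R" "(\<lambda>(d, x). f d x) \<in> borel_measurable (R \<Otimes>\<^sub>M M)"
    "\<And>d. d \<in> space R \<Longrightarrow> f d \<in> borel_measurable M"
    "\<And>d. d \<in> space R \<Longrightarrow> \<exists>b. \<forall>x\<in>space M. \<bar>f d x\<bar> \<le> b"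
    "\<exists>F. integrable R F \<and> (\<forall>d\<in>space R. \<forall>x\<in>space M. \<bar>f d x\<bar> \<le> F d)"
proof -
  show "prob_space R" and m: "(\<lambda>(d, x). f d x) \<in> borel_measurable (R \<Otimes>\<^sub>M M)"
    and "\<And>d. d \<in> space R \<Longrightarrow> \<exists>b. \<forall>x\<in>space M. \<bar>f d x\<bar> \<le> b"
    and "\<exists>F. integrable R F \<and> (\<forall>d\<in>space R. \<forall>x\<in>space M. \<bar>f d x\<bar> \<le> F d)"
    using assms unfolding dominated_channel_def by blast+
  show "f d \<in> borel_measurable M" if "d \<in> space R" for d
    using measurable_Pair_compose_split[OF m measurable_const[OF that] measurable_ident] by simp
qed

lemma dominated_channel_cong_sets:
  assumes "dominated_channel M R f" "sets M' = sets M"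
  shows "dominated_channel M' R f"
  using assms(1) unfolding dominated_channel_def sets_eq_imp_space_eq[OF assms(2)]
    measurable_cong_sets[OF sets_pair_measure_cong[OF refl assms(2)] refl] .

lemma dominated_channel_background:
  assumes f: "dominated_channel M R f" and H: "H \<in> borel_measurable M" "\<And>x. x \<in> space M \<Longrightarrow> \<bar>H x\<bar> \<le> b"
  shows "dominated_channel M R (\<lambda>d x. H x + f d x)"
proof -
  interpret R: prob_space R by (rule dominated_channelD(1)[OF f])
  note [measurable] = dominated_channelD(2)[OF f] H(1)
  obtain F where F: "integrable R F" "\<And>d x. d \<in> space R \<Longrightarrow> x \<in> space M \<Longrightarrow> \<bar>f d x\<bar> \<le> F d"
    using dominated_channelD(5)[OF f] by blast
  show ?thesis
  proof (rule dominated_channelI)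
    show "prob_space R" by unfold_locales
    show "integrable R (\<lambda>d. b + F d)" using F(1) by simp
    show "\<bar>H x + f d x\<bar> \<le> b + F d" if "d \<in> space R" "x \<in> space M" for d x
      using F(2)[OF that] H(2)[OF that(2)] by linarith
  qed measurable
qed

lemma integrable_component_PiM:
  fixes f :: "'a \<Rightarrow> real"
  assumes "\<And>p. p \<in> A \<Longrightarrow> prob_space (Q p)" "p \<in> A" "integrable (Q p) f"
  shows "integrable (Pi\<^sub>M A Q) (\<lambda>D. f (D p))"
proof -
  have "integrable (distr (Pi\<^sub>M A Q) (Q p) (\<lambda>D. D p)) f"
    using assms by (subst distr_PiM_component) auto
  then show ?thesis
    using assms by (subst (asm) integrable_distr_eq) auto
qed

lemma integrable_pair_projections:
  fixes f :: "'a \<Rightarrow> real" and g :: "'b \<Rightarrow> real"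
  assumes "prob_space M" "prob_space N"
  shows "integrable M f \<Longrightarrow> integrable (M \<Otimes>\<^sub>M N) (\<lambda>z. f (fst z))"
    and "integrable N g \<Longrightarrow> integrable (M \<Otimes>\<^sub>M N) (\<lambda>z. g (snd z))"
proof -
  interpret M: prob_space M by fact
  interpret N: prob_space N by fact
  interpret pair_prob_space M N ..
  show "integrable (M \<Otimes>\<^sub>M N) (\<lambda>z. f (fst z))" if "integrable M f"
    using that integrable_distr_eq[of fst "M \<Otimes>\<^sub>M N" M f] by (simp add: N.distr_pair_fst)
  show "integrable (M \<Otimes>\<^sub>M N) (\<lambda>z. g (snd z))" if "integrable N g"
  proof -
    interpret swap: pair_prob_space N M ..
    have "integrable (N \<Otimes>\<^sub>M M) (\<lambda>z. g (fst z))"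
      using that integrable_distr_eq[of fst "N \<Otimes>\<^sub>M M" N g] by (simp add: M.distr_pair_fst)
    from swap.integrable_product_swap[OF this] show ?thesis by (simp add: case_prod_beta')
  qed
qed

lemma dominated_channel_pair:
  assumes f: "dominated_channel M R f" and g: "dominated_channel M S g"
  shows "dominated_channel M (R \<Otimes>\<^sub>M S) (\<lambda>z x. f (fst z) x + g (snd z) x)"
proof -
  interpret R: prob_space R by (rule dominated_channelD(1)[OF f])
  interpret S: prob_space S by (rule dominated_channelD(1)[OF g])
  interpret pair_prob_space R S ..
  note [measurable] = dominated_channelD(2)[OF f] dominated_channelD(2)[OF g]
  obtain F where F: "integrable R F" "\<And>d x. d \<in> space R \<Longrightarrow> x \<in> space M \<Longrightarrow> \<bar>f d x\<bar> \<le> F d"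
    using dominated_channelD(5)[OF f] by blast
  obtain G where G: "integrable S G" "\<And>d x. d \<in> space S \<Longrightarrow> x \<in> space M \<Longrightarrow> \<bar>g d x\<bar> \<le> G d"
    using dominated_channelD(5)[OF g] by blast
  show ?thesis
  proof (rule dominated_channelI)
    show "prob_space (R \<Otimes>\<^sub>M S)" by unfold_locales
    show "integrable (R \<Otimes>\<^sub>M S) (\<lambda>z. F (fst z) + G (snd z))"
      using F(1) G(1) by (intro Bochner_Integration.integrable_add integrable_pair_projections R.prob_space_axioms S.prob_space_axioms)
    show "\<bar>f (fst z) x + g (snd z) x\<bar> \<le> F (fst z) + G (snd z)"
      if "z \<in> space (R \<Otimes>\<^sub>M S)" "x \<in> space M" for z x
      using F(2)[of "fst z" x] G(2)[of "snd z" x] that by (auto simp: space_pair_measure)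
  qed measurable
qed

lemma dominated_channel_PiM:
  assumes Q: "\<And>p. prob_space (Q p)" and u: "\<And>p. p \<in> A \<Longrightarrow> dominated_channel M (Q p) (u p)"
  shows "dominated_channel M (Pi\<^sub>M A Q) (\<lambda>D x. \<Sum>p\<in>A. u p (D p) x)"
proof -
  have "\<forall>p\<in>A. \<exists>F. integrable (Q p) F \<and> (\<forall>d\<in>space (Q p). \<forall>x\<in>space M. \<bar>u p d x\<bar> \<le> F d)"
    by (intro ballI dominated_channelD(5) u)
  from bchoice[OF this] obtain U where U: "\<And>p. p \<in> A \<Longrightarrow> integrable (Q p) (U p)"
    "\<And>p d x. p \<in> A \<Longrightarrow> d \<in> space (Q p) \<Longrightarrow> x \<in> space M \<Longrightarrow> \<bar>u p d x\<bar> \<le> U p d"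
    by auto
  show ?thesis
  proof (rule dominated_channelI)
    show "prob_space (Pi\<^sub>M A Q)" by (intro prob_space_PiM Q)
    show "integrable (Pi\<^sub>M A Q) (\<lambda>D. \<Sum>p\<in>A. U p (D p))"
      by (intro Bochner_Integration.integrable_sum integrable_component_PiM Q U(1))
    show "\<bar>\<Sum>p\<in>A. u p (D p) x\<bar> \<le> (\<Sum>p\<in>A. U p (D p))" if "D \<in> space (Pi\<^sub>M A Q)" "x \<in> space M" for D x
      using that by (intro order_trans[OF sum_abs] sum_mono U(2)) (auto simp: space_PiM PiE_def)
    have "(\<lambda>z. u p (fst z p) (snd z)) \<in> borel_measurable (Pi\<^sub>M A Q \<Otimes>\<^sub>M M)" if p: "p \<in> A" for p
      by (rule measurable_Pair_compose_split[OF dominated_channelD(2)[OF u[OF p]]]) (use p in measurable)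
    then show "(\<lambda>(D, x). \<Sum>p\<in>A. u p (D p) x) \<in> borel_measurable (Pi\<^sub>M A Q \<Otimes>\<^sub>M M)"
      by (auto simp: case_prod_beta' intro!: borel_measurable_sum)
  qed
qed

lemma (in prob_space) log_partition_integrable:
  assumes f: "dominated_channel M R f"
  shows "integrable R (\<lambda>d. ln (\<integral>x. exp (f d x) \<partial>M))"
proof -
  note [measurable] = dominated_channelD(2)[OF f]
  obtain F where F: "integrable R F" "\<And>d x. d \<in> space R \<Longrightarrow> x \<in> space M \<Longrightarrow> \<bar>f d x\<bar> \<le> F d"
    using dominated_channelD(5)[OF f] by blast
  have b: "\<bar>ln (\<integral>x. exp (f d x) \<partial>M)\<bar> \<le> F d" if "d \<in> space R" for d
    by (rule log_exp_moment_bound(3)) (use F(2) that dominated_channelD(3)[OF f] in auto)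
  have "(\<lambda>d. ln (\<integral>x. exp (f d x) \<partial>M)) \<in> borel_measurable R"
    by measurable
  then show ?thesis
    using b by (intro Bochner_Integration.integrable_bound[OF F(1)]) (auto intro!: AE_I2 order_trans[OF b])
qed

lemma (in prob_space) log_partition_insert:
  fixes H :: "'a \<Rightarrow> real"
  assumes A: "finite A" "q \<notin> A" and Q: "\<And>p. prob_space (Q p)"
    and u: "\<And>p. p \<in> insert q A \<Longrightarrow> dominated_channel M (Q p) (u p)"
    and H: "H \<in> borel_measurable M" "\<And>x. x \<in> space M \<Longrightarrow> \<bar>H x\<bar> \<le> b"
  shows "(\<integral>D. ln (\<integral>x. exp (H x + (\<Sum>p\<in>insert q A. u p (D p) x)) \<partial>M) \<partial>Pi\<^sub>M (insert q A) Q)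
    = (\<integral>D. (\<integral>d. ln (\<integral>x. exp (H x + (u q d x + (\<Sum>p\<in>A. u p (D p) x))) \<partial>M) \<partial>Q q) \<partial>Pi\<^sub>M A Q)"
proof -
  interpret Q: product_prob_space Q by (rule product_prob_spaceI) (rule Q)
  have "(\<Sum>p\<in>insert q A. u p ((D(q := d)) p) x) = u q d x + (\<Sum>p\<in>A. u p (D p) x)" for D d x
    using A by (simp, intro sum.cong) auto
  then show ?thesis
    using Q.product_integral_insert[OF A log_partition_integrable[OF
      dominated_channel_background[OF dominated_channel_PiM[OF Q u] H]]]
    by (simp only:)
qed

text \<open>\<open>M'\<close> is the Gibbs measure with density \<open>exp H / Z\<close>. It trades
  a background Hamiltonian for a change of measure and a factor that does not depend on
  \<open>u\<close>.\<close>

lemma (in prob_space) exponential_tilt: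
  fixes H :: "'a \<Rightarrow> real"
  assumes H[measurable]: "H \<in> borel_measurable M" and Hb: "\<And>x. x \<in> space M \<Longrightarrow> \<bar>H x\<bar> \<le> b"
  obtains M' where "prob_space M'" "sets M' = sets M" "0 < (\<integral>x. exp (H x) \<partial>M)"
    "\<And>u :: 'a \<Rightarrow> real. u \<in> borel_measurable M \<Longrightarrow>
      (\<integral>x. exp (H x + u x) \<partial>M) = (\<integral>x. exp (H x) \<partial>M) * (\<integral>x. exp (u x) \<partial>M')"
proof -
  define Z where "Z = (\<integral>x. exp (H x) \<partial>M)"
  define M' where "M' = density M (\<lambda>x. ennreal (exp (H x) / Z))"
  have i: "integrable M (\<lambda>x. exp (H x))"
    by (rule log_exp_moment_bound(1)[OF H Hb])
  have "exp (- b) \<le> Z" unfolding Z_def by (rule log_exp_moment_bound(2)[OF H Hb])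
  then have Z: "0 < Z" using exp_gt_zero[of "- b"] by linarith
  show ?thesis
  proof (rule that)
    have "emeasure M' (space M') = ennreal (\<integral>x. exp (H x) / Z \<partial>M)"
      unfolding M'_def using i Z
      by (subst emeasure_density, simp, simp, subst nn_integral_eq_integral[symmetric])
        (auto intro!: nn_integral_cong simp: indicator_def)
    then show "prob_space M'" using Z by (intro prob_spaceI) (simp add: Z_def[symmetric])
    show "sets M' = sets M" by (simp add: M'_def)
    show "0 < (\<integral>x. exp (H x) \<partial>M)" using Z by (simp add: Z_def)
    fix u :: "'a \<Rightarrow> real" assume [measurable]: "u \<in> borel_measurable M"
    have "(\<integral>x. exp (u x) \<partial>M') = (\<integral>x. exp (H x + u x) / Z \<partial>M)"
      unfolding M'_def using Z by (subst integral_density) (auto simp: exp_add)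
    then show "(\<integral>x. exp (H x + u x) \<partial>M) = (\<integral>x. exp (H x) \<partial>M) * (\<integral>x. exp (u x) \<partial>M')"
      using Z by (simp add: Z_def[symmetric])
  qed
qed

text \<open>The background adds the same constant \<open>ln Z\<close> to both averages, so it
  cancels, and the comparison under its Gibbs measure is left. Hence \<open>one_step\<close> is
  required for all probability measures on the same sigma-algebra.\<close>

lemma (in prob_space) tilted_comparison:
  fixes H :: "'a \<Rightarrow> real"
  assumes u: "dominated_channel M Q u" and v: "dominated_channel M G v"
    and one_step: "\<And>M'. prob_space M' \<Longrightarrow> sets M' = sets M \<Longrightarrow>
      \<bar>(\<integral>d. ln (\<integral>x. exp (u d x) \<partial>M') \<partial>Q) - (\<integral>e. ln (\<integral>x. exp (v e x) \<partial>M') \<partial>G)\<bar> \<le> \<epsilon>"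
    and H: "H \<in> borel_measurable M" "\<And>x. x \<in> space M \<Longrightarrow> \<bar>H x\<bar> \<le> b"
  shows "\<bar>(\<integral>d. ln (\<integral>x. exp (H x + u d x) \<partial>M) \<partial>Q) - (\<integral>e. ln (\<integral>x. exp (H x + v e x) \<partial>M) \<partial>G)\<bar> \<le> \<epsilon>"
proof -
  obtain M' where M': "prob_space M'" "sets M' = sets M" and Z: "0 < (\<integral>x. exp (H x) \<partial>M)"
    and eq: "\<And>u :: 'a \<Rightarrow> real. u \<in> borel_measurable M \<Longrightarrow>
      (\<integral>x. exp (H x + u x) \<partial>M) = (\<integral>x. exp (H x) \<partial>M) * (\<integral>x. exp (u x) \<partial>M')"
    using exponential_tilt[OF H] by metis
  interpret M': prob_space M' by (rule M')
  \<comment> \<open>The noise space is left polymorphic, as the two channels may live on different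
    spaces.\<close>
  have shift: "(\<integral>d. ln (\<integral>x. exp (H x + f d x) \<partial>M) \<partial>R) =
      ln (\<integral>x. exp (H x) \<partial>M) + (\<integral>d. ln (\<integral>x. exp (f d x) \<partial>M') \<partial>R)"
    if f: "dominated_channel M R f" for R :: "'z measure" and f
  proof -
    interpret R: prob_space R by (rule dominated_channelD(1)[OF f])
    have f': "dominated_channel M' R f" by (rule dominated_channel_cong_sets[OF f M'(2)])
    have "(\<integral>d. ln (\<integral>x. exp (H x + f d x) \<partial>M) \<partial>R) =
        (\<integral>d. ln (\<integral>x. exp (H x) \<partial>M) + ln (\<integral>x. exp (f d x) \<partial>M') \<partial>R)"
    proof (rule Bochner_Integration.integral_cong[OF refl])
      fix d assume d: "d \<in> space R"
      obtain b where b: "\<And>x. x \<in> space M' \<Longrightarrow> \<bar>f d x\<bar> \<le> b" using dominated_channelD(4)[OF f' d] by blast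
      have "exp (- b) \<le> (\<integral>x. exp (f d x) \<partial>M')"
        by (rule M'.log_exp_moment_bound(2)[OF dominated_channelD(3)[OF f' d] b])
      then have "0 < (\<integral>x. exp (f d x) \<partial>M')" using exp_gt_zero[of "- b"] by linarith
      then show "ln (\<integral>x. exp (H x + f d x) \<partial>M) = ln (\<integral>x. exp (H x) \<partial>M) + ln (\<integral>x. exp (f d x) \<partial>M')"
        unfolding eq[OF dominated_channelD(3)[OF f d]] using Z by (simp add: ln_mult_pos)
    qed
    also have "\<dots> = ln (\<integral>x. exp (H x) \<partial>M) + (\<integral>d. ln (\<integral>x. exp (f d x) \<partial>M') \<partial>R)"
      using M'.log_partition_integrable[OF f'] by (simp add: R.prob_space)
    finally show ?thesis .
  qed
  show ?thesis
    using shift[OF u] shift[OF v] one_step[OF M'] by simp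
qed

text \<open>
  Lindeberg's exchange: the channels are replaced one after the other, those not yet touched and those
  already replaced being absorbed into the background \<open>H\<close>.
\<close>

lemma (in prob_space) channel_exchange:
  fixes H :: "'a \<Rightarrow> real"
  assumes A: "finite A" and Q: "\<And>p. prob_space (Q p)" and G: "\<And>p. prob_space (G p)"
    and u: "\<And>p. p \<in> A \<Longrightarrow> dominated_channel M (Q p) (u p)"
    and v: "\<And>p. p \<in> A \<Longrightarrow> dominated_channel M (G p) (v p)"
    and one_step: "\<And>p M'. p \<in> A \<Longrightarrow> prob_space M' \<Longrightarrow> sets M' = sets M \<Longrightarrow>
      \<bar>(\<integral>d. ln (\<integral>x. exp (u p d x) \<partial>M') \<partial>Q p) - (\<integral>e. ln (\<integral>x. exp (v p e x) \<partial>M') \<partial>G p)\<bar> \<le> \<epsilon>"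
    and H: "H \<in> borel_measurable M" "\<And>x. x \<in> space M \<Longrightarrow> \<bar>H x\<bar> \<le> b"
  shows "\<bar>(\<integral>D. ln (\<integral>x. exp (H x + (\<Sum>p\<in>A. u p (D p) x)) \<partial>M) \<partial>Pi\<^sub>M A Q)
        - (\<integral>W. ln (\<integral>x. exp (H x + (\<Sum>p\<in>A. v p (W p) x)) \<partial>M) \<partial>Pi\<^sub>M A G)\<bar> \<le> real (card A) * \<epsilon>"
  using A u v one_step H
proof (induction A arbitrary: H b rule: finite_induct)
  case empty
  then show ?case by (simp add: PiM_empty)
next
  case (insert q A)
  note H = insert.prems(4,5)
  have uA: "\<And>p. p \<in> A \<Longrightarrow> dominated_channel M (Q p) (u p)"
    and vA: "\<And>p. p \<in> A \<Longrightarrow> dominated_channel M (G p) (v p)"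
    and uq: "dominated_channel M (Q q) (u q)" and vq: "dominated_channel M (G q) (v q)"
    using insert.prems by auto
  note su = dominated_channel_PiM[OF Q uA] and sv = dominated_channel_PiM[OF G vA]
  interpret QA: prob_space "Pi\<^sub>M A Q" by (rule prob_space_PiM) (rule Q)
  interpret GA: prob_space "Pi\<^sub>M A G" by (rule prob_space_PiM) (rule G)
  interpret Qq: prob_space "Q q" by (rule Q)
  interpret Gq: prob_space "G q" by (rule G)
  interpret PQ: pair_prob_space "Q q" "Pi\<^sub>M A Q" ..
  interpret PG: pair_prob_space "Q q" "Pi\<^sub>M A G" ..
  interpret PV: pair_prob_space "G q" "Pi\<^sub>M A G" ..
  \<comment> \<open>Three hybrids: all channels original, only \<open>q\<close> original, all
    replaced.\<close>
  define LQ where "LQ d D = ln (\<integral>x. exp (H x + (u q d x + (\<Sum>p\<in>A. u p (D p) x))) \<partial>M)" for d D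
  define LG where "LG d W = ln (\<integral>x. exp (H x + (u q d x + (\<Sum>p\<in>A. v p (W p) x))) \<partial>M)" for d W
  define LV where "LV e W = ln (\<integral>x. exp (H x + (v q e x + (\<Sum>p\<in>A. v p (W p) x))) \<partial>M)" for e W
  have iLQ: "integrable (Q q \<Otimes>\<^sub>M Pi\<^sub>M A Q) (case_prod LQ)"
    and iLG: "integrable (Q q \<Otimes>\<^sub>M Pi\<^sub>M A G) (case_prod LG)"
    and iLV: "integrable (G q \<Otimes>\<^sub>M Pi\<^sub>M A G) (case_prod LV)"
    unfolding LQ_def LG_def LV_def case_prod_beta'
    by (rule log_partition_integrable dominated_channel_background dominated_channel_pair
      uq vq su sv H | assumption)+
  \<comment> \<open>The datum of \<open>q\<close> goes outside: once it is fixed,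
    \<open>u q d\<close> joins the background and the induction hypothesis applies to
    \<open>A\<close>.\<close>
  have fQ: "(\<integral>D. ln (\<integral>x. exp (H x + (\<Sum>p\<in>insert q A. u p (D p) x)) \<partial>M) \<partial>Pi\<^sub>M (insert q A) Q)
      = (\<integral>d. (\<integral>D. LQ d D \<partial>Pi\<^sub>M A Q) \<partial>Q q)"
    using log_partition_insert[where u=u, OF insert.hyps(1,2) Q insert.prems(1) H] PQ.Fubini_integral[OF iLQ]
    unfolding LQ_def by (rule trans)
  \<comment> \<open>Here the noise of the other, already replaced channels stays outside: for fixed
    \<open>W\<close> they form the background of the single exchange at \<open>q\<close>.\<close>
  have fV: "(\<integral>D. ln (\<integral>x. exp (H x + (\<Sum>p\<in>insert q A. v p (D p) x)) \<partial>M) \<partial>Pi\<^sub>M (insert q A) G)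
      = (\<integral>D. (\<integral>d. LV d D \<partial>G q) \<partial>Pi\<^sub>M A G)"
    using log_partition_insert[where u=v, OF insert.hyps(1,2) G insert.prems(2) H]
    unfolding LV_def .
  have e1: "\<bar>(\<integral>d. (\<integral>D. LQ d D \<partial>Pi\<^sub>M A Q) \<partial>Q q) - (\<integral>d. (\<integral>W. LG d W \<partial>Pi\<^sub>M A G) \<partial>Q q)\<bar> \<le> real (card A) * \<epsilon>"
  proof -
    have "(\<integral>d. (\<integral>D. LQ d D \<partial>Pi\<^sub>M A Q) \<partial>Q q) - (\<integral>d. (\<integral>W. LG d W \<partial>Pi\<^sub>M A G) \<partial>Q q)
       = (\<integral>d. (\<integral>D. LQ d D \<partial>Pi\<^sub>M A Q) - (\<integral>W. LG d W \<partial>Pi\<^sub>M A G) \<partial>Q q)"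
      using PQ.integrable_fst[OF iLQ] PG.integrable_fst[OF iLG] by simp
    also have "\<bar>\<dots>\<bar> \<le> real (card A) * \<epsilon>"
    proof (rule Qq.abs_expectation_le)
      show "(\<lambda>d. (\<integral>D. LQ d D \<partial>Pi\<^sub>M A Q) - (\<integral>W. LG d W \<partial>Pi\<^sub>M A G)) \<in> borel_measurable (Q q)"
        using PQ.integrable_fst[OF iLQ] PG.integrable_fst[OF iLG] by simp
      fix d assume d: "d \<in> space (Q q)"
      obtain b' where b': "\<And>x. x \<in> space M \<Longrightarrow> \<bar>u q d x\<bar> \<le> b'" using dominated_channelD(4)[OF uq d] by blast
      show "\<bar>(\<integral>D. LQ d D \<partial>Pi\<^sub>M A Q) - (\<integral>W. LG d W \<partial>Pi\<^sub>M A G)\<bar> \<le> real (card A) * \<epsilon>"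
        unfolding LQ_def LG_def add.assoc[symmetric]
      proof (rule insert.IH[OF uA vA])
        show "(\<lambda>x. H x + u q d x) \<in> borel_measurable M"
          by (intro borel_measurable_add H dominated_channelD(3)[OF uq d])
        show "\<bar>H x + u q d x\<bar> \<le> b + b'" if "x \<in> space M" for x
          using b'[OF that] H(2)[OF that] by linarith
      qed (use insert.prems(3) in auto)
    qed
    finally show ?thesis .
  qed
  have e2: "\<bar>(\<integral>W. (\<integral>d. LG d W \<partial>Q q) \<partial>Pi\<^sub>M A G) - (\<integral>W. (\<integral>e. LV e W \<partial>G q) \<partial>Pi\<^sub>M A G)\<bar> \<le> \<epsilon>"
  proof -
    have "(\<integral>W. (\<integral>d. LG d W \<partial>Q q) \<partial>Pi\<^sub>M A G) - (\<integral>W. (\<integral>e. LV e W \<partial>G q) \<partial>Pi\<^sub>M A G)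
       = (\<integral>W. (\<integral>d. LG d W \<partial>Q q) - (\<integral>e. LV e W \<partial>G q) \<partial>Pi\<^sub>M A G)"
      using PG.integrable_snd[OF iLG] PV.integrable_snd[OF iLV] by simp
    also have "\<bar>\<dots>\<bar> \<le> \<epsilon>"
    proof (rule GA.abs_expectation_le)
      show "(\<lambda>W. (\<integral>d. LG d W \<partial>Q q) - (\<integral>e. LV e W \<partial>G q)) \<in> borel_measurable (Pi\<^sub>M A G)"
        using PG.integrable_snd[OF iLG] PV.integrable_snd[OF iLV] by simp
      fix W assume W: "W \<in> space (Pi\<^sub>M A G)"
      obtain b' where b': "\<And>x. x \<in> space M \<Longrightarrow> \<bar>\<Sum>p\<in>A. v p (W p) x\<bar> \<le> b'"
        using dominated_channelD(4)[OF sv W] by blast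
      have "\<bar>(\<integral>d. ln (\<integral>x. exp ((H x + (\<Sum>p\<in>A. v p (W p) x)) + u q d x) \<partial>M) \<partial>Q q)
          - (\<integral>e. ln (\<integral>x. exp ((H x + (\<Sum>p\<in>A. v p (W p) x)) + v q e x) \<partial>M) \<partial>G q)\<bar> \<le> \<epsilon>"
      proof (rule tilted_comparison[OF uq vq])
        show "(\<lambda>x. H x + (\<Sum>p\<in>A. v p (W p) x)) \<in> borel_measurable M"
          by (intro borel_measurable_add H dominated_channelD(3)[OF sv W])
        show "\<bar>H x + (\<Sum>p\<in>A. v p (W p) x)\<bar> \<le> b + b'" if "x \<in> space M" for x
          using b'[OF that] H(2)[OF that] by linarith
      qed (use insert.prems(3) in auto)
      then show "\<bar>(\<integral>d. LG d W \<partial>Q q) - (\<integral>e. LV e W \<partial>G q)\<bar> \<le> \<epsilon>"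
        unfolding LG_def LV_def by (simp only: ac_simps)
    qed
    finally show ?thesis .
  qed
  \<comment> \<open>The two estimates meet in the average of \<open>LG\<close>, taken with
    \<open>d\<close> outside in one and with \<open>W\<close> outside in the other; Fubini
    identifies them.\<close>
  show ?case
    unfolding fQ fV using e1 e2 PG.Fubini_integral[OF iLG] insert.hyps
    by (simp add: algebra_simps)
qed

section \<open>Expansion of a single channel\<close>

text \<open>Common core of both channels. \<open>m1\<close>, \<open>m2\<close>, \<open>m3\<close>
  are approximate score identities for data drawn at overlap \<open>w0\<close>, with
  \<open>I\<close> the Fisher information. Their errors may be of orders \<open>c\<^sup>2\<close>,
  \<open>c\<close> and \<open>c\<close>, because they multiply the mean of \<open>w\<close> (order
  \<open>c\<close>) and quadratic quantities (order \<open>c\<^sup>2\<close>). \<open>E\<close> is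
  an integrable majorant whose mean is easy to compute.\<close>

lemma (in prob_space) averaged_quadratic_expansion:
  fixes w :: "'a \<Rightarrow> real" and \<alpha> \<beta> T E :: "'e \<Rightarrow> real"
  assumes w[measurable]: "w \<in> borel_measurable M" and wc: "\<And>x. x \<in> space M \<Longrightarrow> \<bar>w x\<bar> \<le> c"
    and v: "dominated_channel M Q v"
    and int: "integrable Q \<alpha>" "integrable Q (\<lambda>d. (\<alpha> d)\<^sup>2)" "integrable Q \<beta>" "integrable Q E"
    and vw: "\<And>d x. d \<in> space Q \<Longrightarrow> x \<in> space M \<Longrightarrow>
      \<bar>v d x - \<alpha> d * w x - \<beta> d * (w x)\<^sup>2 / 2\<bar> \<le> K * c ^ 3"
    and c: "c \<le> 1" and K: "1 \<le> K"
    and T: "\<And>d. d \<in> space Q \<Longrightarrow> \<bar>\<alpha> d\<bar> \<le> T d" and \<beta>: "\<And>d. d \<in> space Q \<Longrightarrow> \<bar>\<beta> d\<bar> \<le> K"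
    and E: "\<And>d. d \<in> space Q \<Longrightarrow> (T d + 2 * K) ^ 3 \<le> E d" "(\<integral>d. E d \<partial>Q) \<le> L"
    and m1: "\<bar>(\<integral>d. \<alpha> d \<partial>Q) - w0 * I\<bar> \<le> K * c\<^sup>2"
    and m2: "\<bar>(\<integral>d. \<beta> d + (\<alpha> d)\<^sup>2 \<partial>Q)\<bar> \<le> K * c" and m3: "\<bar>(\<integral>d. (\<alpha> d)\<^sup>2 \<partial>Q) - I\<bar> \<le> K * c"
  shows "\<bar>(\<integral>d. ln (\<integral>x. exp (v d x) \<partial>M) \<partial>Q) - I * (w0 * expectation w - (expectation w)\<^sup>2 / 2)\<bar>
    \<le> (55 * L + 2 * K) * c ^ 3"
proof -
  interpret Q: prob_space Q by (rule dominated_channelD(1)[OF v])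
  define m q where "m = expectation w" "q = expectation (\<lambda>x. (w x)\<^sup>2)"
  define \<Phi> where "\<Phi> d = \<alpha> d * m + (\<beta> d + (\<alpha> d)\<^sup>2) * q / 2 - (\<alpha> d)\<^sup>2 * m\<^sup>2 / 2" for d
  obtain x where "x \<in> space M" using not_empty by blast
  then have c0: "0 \<le> c" using wc[of x] by linarith
  have w2: "\<bar>(w x)\<^sup>2\<bar> \<le> c\<^sup>2" if "x \<in> space M" for x
    using wc[OF that] by (simp add: abs_le_square_iff[symmetric])
  have m: "\<bar>m\<bar> \<le> c" unfolding m_q_def by (rule abs_expectation_le(2)[OF w wc])
  have q: "\<bar>q\<bar> \<le> c\<^sup>2" unfolding m_q_def by (rule abs_expectation_le(2)[OF _ w2]) measurable
  have mm: "\<bar>m\<^sup>2\<bar> \<le> c\<^sup>2" using m by (simp add: abs_le_square_iff[symmetric])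
  have i\<Phi>: "integrable Q \<Phi>" unfolding \<Phi>_def using int by simp
  note iv = log_partition_integrable[OF v]
  have "(\<integral>d. ln (\<integral>x. exp (v d x) \<partial>M) \<partial>Q) - (\<integral>d. \<Phi> d \<partial>Q) = (\<integral>d. ln (\<integral>x. exp (v d x) \<partial>M) - \<Phi> d \<partial>Q)"
    using iv i\<Phi> by simp
  also have "\<bar>\<dots>\<bar> \<le> (\<integral>d. \<bar>ln (\<integral>x. exp (v d x) \<partial>M) - \<Phi> d\<bar> \<partial>Q)" by (rule integral_abs_bound)
  also have "\<dots> \<le> (\<integral>d. 55 * c ^ 3 * E d \<partial>Q)"
  proof (rule integral_mono)
    fix d assume d: "d \<in> space Q"
    have "\<bar>ln (\<integral>x. exp (v d x) \<partial>M) - \<Phi> d\<bar> \<le> 55 * c ^ 3 * (T d + 2 * K) ^ 3"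
      unfolding \<Phi>_def m_q_def
      by (rule quadratic_log_expansion[OF w wc dominated_channelD(3)[OF v d] vw[OF d] c K T[OF d] \<beta>[OF d]])
    also have "\<dots> \<le> 55 * c ^ 3 * E d" using c0 by (intro mult_left_mono E(1)[OF d]) simp
    finally show "\<bar>ln (\<integral>x. exp (v d x) \<partial>M) - \<Phi> d\<bar> \<le> 55 * c ^ 3 * E d" .
  qed (use iv i\<Phi> int in simp_all)
  also have "\<dots> \<le> 55 * c ^ 3 * L" using E(2) c0 by (auto intro: mult_left_mono)
  finally have 1: "\<bar>(\<integral>d. ln (\<integral>x. exp (v d x) \<partial>M) \<partial>Q) - (\<integral>d. \<Phi> d \<partial>Q)\<bar> \<le> 55 * c ^ 3 * L" .
  \<comment> \<open>Collected by \<open>m\<close>, \<open>q\<close> and \<open>m\<^sup>2\<close>,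
    the deviation from the leading part consists of the three defects bounded in \<open>m1\<close>,
    \<open>m2\<close> and \<open>m3\<close>.\<close>
  have "(\<integral>d. \<Phi> d \<partial>Q) - I * (w0 * m - m\<^sup>2 / 2) = ((\<integral>d. \<alpha> d \<partial>Q) - w0 * I) * m
      + (\<integral>d. \<beta> d + (\<alpha> d)\<^sup>2 \<partial>Q) * q / 2 - ((\<integral>d. (\<alpha> d)\<^sup>2 \<partial>Q) - I) * m\<^sup>2 / 2"
    unfolding \<Phi>_def using int by (simp add: algebra_simps diff_divide_distrib)
  moreover have "\<bar>((\<integral>d. \<alpha> d \<partial>Q) - w0 * I) * m\<bar> \<le> K * c\<^sup>2 * c"
    unfolding abs_mult using K by (intro mult_mono m1 m) auto
  moreover have "\<bar>(\<integral>d. \<beta> d + (\<alpha> d)\<^sup>2 \<partial>Q) * q\<bar> \<le> K * c * c\<^sup>2"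
    unfolding abs_mult using K c0 by (intro mult_mono m2 q) auto
  moreover have "\<bar>((\<integral>d. (\<alpha> d)\<^sup>2 \<partial>Q) - I) * m\<^sup>2\<bar> \<le> K * c * c\<^sup>2"
    unfolding abs_mult[of _ "m\<^sup>2"] using K c0 by (intro mult_mono m3 mm) auto
  moreover have "K * c\<^sup>2 * c = K * c ^ 3" "K * c * c\<^sup>2 = K * c ^ 3"
    by (simp_all add: power2_eq_square power3_eq_cube)
  ultimately have "\<bar>(\<integral>d. \<Phi> d \<partial>Q) - I * (w0 * m - m\<^sup>2 / 2)\<bar> \<le> 2 * (K * c ^ 3)" by linarith
  moreover have "55 * c ^ 3 * L + 2 * (K * c ^ 3) = (55 * L + 2 * K) * c ^ 3" by (simp add: algebra_simps)
  ultimately show ?thesis using 1 unfolding m_q_def by linarith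
qed

text \<open>Substitute for the expansion when \<open>c\<close> is not small: the two terms are
  bounded separately, with no cancellation between them.\<close>

lemma (in prob_space) coarse_log_expansion:
  fixes w :: "'a \<Rightarrow> real"
  assumes w: "w \<in> borel_measurable M" and wc: "\<And>x. x \<in> space M \<Longrightarrow> \<bar>w x\<bar> \<le> c" and w0: "\<bar>w0\<bar> \<le> c"
    and v: "dominated_channel M Q v" and S: "integrable Q S" "(\<integral>d. S d \<partial>Q) \<le> s"
    and vS: "\<And>d x. d \<in> space Q \<Longrightarrow> x \<in> space M \<Longrightarrow> \<bar>v d x\<bar> \<le> S d"
    and I: "0 \<le> I"
  shows "\<bar>(\<integral>d. ln (\<integral>x. exp (v d x) \<partial>M) \<partial>Q) - I * (w0 * expectation w - (expectation w)\<^sup>2 / 2)\<bar>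
    \<le> s + 3 / 2 * I * c\<^sup>2"
proof -
  note iv = log_partition_integrable[OF v]
  have "\<bar>(\<integral>d. ln (\<integral>x. exp (v d x) \<partial>M) \<partial>Q)\<bar> \<le> (\<integral>d. \<bar>ln (\<integral>x. exp (v d x) \<partial>M)\<bar> \<partial>Q)"
    by (rule integral_abs_bound)
  also have "\<dots> \<le> (\<integral>d. S d \<partial>Q)"
    by (rule integral_mono)
      (use iv S log_exp_moment_bound(3)[OF dominated_channelD(3)[OF v] vS] in auto)
  finally have 1: "\<bar>(\<integral>d. ln (\<integral>x. exp (v d x) \<partial>M) \<partial>Q)\<bar> \<le> s" using S(2) by linarith
  have m: "\<bar>expectation w\<bar> \<le> c" by (rule abs_expectation_le(2)[OF w wc])
  have "\<bar>w0 * expectation w\<bar> \<le> c * c" unfolding abs_mult using m w0 by (intro mult_mono) auto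
  moreover have "\<bar>(expectation w)\<^sup>2\<bar> \<le> c\<^sup>2" using m by (simp add: abs_le_square_iff[symmetric])
  ultimately have "\<bar>w0 * expectation w - (expectation w)\<^sup>2 / 2\<bar> \<le> 3 / 2 * c\<^sup>2"
    unfolding power2_eq_square[of c] by linarith
  then have "\<bar>I * (w0 * expectation w - (expectation w)\<^sup>2 / 2)\<bar> \<le> I * (3 / 2 * c\<^sup>2)"
    unfolding abs_mult using I by (intro mult_mono) auto
  moreover have "I * (3 / 2 * c\<^sup>2) = 3 / 2 * I * c\<^sup>2" by simp
  ultimately show ?thesis using 1 by linarith
qed

section \<open>The Gaussian channel\<close>

lemma std_normal_moments:
  shows "integrable std_normal_distribution (\<lambda>x. x ^ k)"
    and "(\<integral>x. x \<partial>std_normal_distribution) = 0"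
    and "(\<integral>x. x\<^sup>2 \<partial>std_normal_distribution) = 1"
    and "(\<integral>x. x ^ 4 \<partial>std_normal_distribution) = 3"
  using integrable_std_normal_moment[of k] integral_std_normal_moment_odd[of 0]
    integral_std_normal_moment_even[of 1] integral_std_normal_moment_even[of 2]
  by (simp_all add: integrable_density integral_density normal_density_nonneg fact_numeral)

lemma cube_dominates_lower_powers:
  fixes B c :: real
  assumes "1 \<le> B" "1 \<le> 3 * B * c"
  shows "c \<le> 9 * B\<^sup>2 * c ^ 3" "c\<^sup>2 \<le> 3 * B * c ^ 3"
proof -
  have c: "0 \<le> c" using assms zero_less_mult_pos[of "3 * B" c] by linarith
  show 2: "c\<^sup>2 \<le> 3 * B * c ^ 3"
    using mult_right_mono[OF assms(2), of "c\<^sup>2"] by (simp add: power2_eq_square power3_eq_cube mult_ac)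
  have "c \<le> 3 * B * c\<^sup>2"
    using mult_right_mono[OF assms(2) c] by (simp add: power2_eq_square mult_ac)
  also have "\<dots> \<le> 3 * B * (3 * B * c ^ 3)" using 2 assms(1) by (intro mult_left_mono) auto
  finally show "c \<le> 9 * B\<^sup>2 * c ^ 3" by (simp add: power2_eq_square mult_ac)
qed

text \<open>With \<open>a\<^sup>2\<close> in the role of \<open>1 / \<Delta>\<close>, the random
  Hamiltonian is the contribution of one pair to \<open>gauss_hamiltonian\<close>: \<open>e\<close>
  is the noise, \<open>w\<close> the overlap and \<open>w0\<close> the true overlap.\<close>

lemma gauss_channel_dominated:
  fixes w :: "'a \<Rightarrow> real"
  assumes w[measurable]: "w \<in> borel_measurable M" and wc: "\<And>x. x \<in> space M \<Longrightarrow> \<bar>w x\<bar> \<le> c" and w0: "\<bar>w0\<bar> \<le> c"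
    and a: "0 \<le> a" "a \<le> B" and c: "0 \<le> c"
  shows "dominated_channel M std_normal_distribution
      (\<lambda>e x. a * e * w x + a\<^sup>2 * w0 * w x - a\<^sup>2 * (w x)\<^sup>2 / 2)"
    and "\<And>e x. x \<in> space M \<Longrightarrow> \<bar>a * e * w x + a\<^sup>2 * w0 * w x - a\<^sup>2 * (w x)\<^sup>2 / 2\<bar>
      \<le> B * c * ((1 + e\<^sup>2) / 2) + 3 / 2 * B\<^sup>2 * c\<^sup>2"
proof -
  show b: "\<bar>a * e * w x + a\<^sup>2 * w0 * w x - a\<^sup>2 * (w x)\<^sup>2 / 2\<bar>
      \<le> B * c * ((1 + e\<^sup>2) / 2) + 3 / 2 * B\<^sup>2 * c\<^sup>2" if x: "x \<in> space M" for e x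
  proof -
    \<comment> \<open>The resulting majorant \<open>(1 + e\<^sup>2) / 2\<close> of
      \<open>\<bar>e\<bar>\<close> has mean 1 under the normal law and avoids absolute
      moments.\<close>
    have "0 \<le> (1 - \<bar>e\<bar>)\<^sup>2" by simp
    then have e: "\<bar>e\<bar> \<le> (1 + e\<^sup>2) / 2" by (simp add: power2_eq_square algebra_simps)
    have aa: "a\<^sup>2 \<le> B\<^sup>2" using a by (intro power_mono)
    have ww: "(w x)\<^sup>2 \<le> c\<^sup>2" using wc[OF x] by (simp add: abs_le_square_iff[symmetric] c)
    have "\<bar>a * e * w x\<bar> = a * \<bar>w x\<bar> * \<bar>e\<bar>" using a by (simp add: abs_mult)
    also have "\<dots> \<le> B * c * ((1 + e\<^sup>2) / 2)" using a e wc[OF x] c by (intro mult_mono) auto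
    finally have 1: "\<bar>a * e * w x\<bar> \<le> B * c * ((1 + e\<^sup>2) / 2)" .
    have "\<bar>a\<^sup>2 * w0 * w x\<bar> = a\<^sup>2 * (\<bar>w0\<bar> * \<bar>w x\<bar>)" by (simp add: abs_mult)
    also have "\<dots> \<le> B\<^sup>2 * (c * c)" using aa wc[OF x] w0 c by (intro mult_mono) auto
    finally have 2: "\<bar>a\<^sup>2 * w0 * w x\<bar> \<le> B\<^sup>2 * c\<^sup>2" by (simp add: power2_eq_square)
    have 3: "a\<^sup>2 * (w x)\<^sup>2 \<le> B\<^sup>2 * c\<^sup>2" "0 \<le> a\<^sup>2 * (w x)\<^sup>2" using aa ww by (auto intro!: mult_mono)
    show ?thesis using 1 2 3 by linarith
  qed
  interpret N: prob_space std_normal_distribution by (rule prob_space_normal_density) simp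
  show "dominated_channel M std_normal_distribution
      (\<lambda>e x. a * e * w x + a\<^sup>2 * w0 * w x - a\<^sup>2 * (w x)\<^sup>2 / 2)"
  proof (rule dominated_channelI[OF N.prob_space_axioms _ _ b])
    show "integrable std_normal_distribution (\<lambda>e. B * c * ((1 + e\<^sup>2) / 2) + 3 / 2 * B\<^sup>2 * c\<^sup>2)"
      using std_normal_moments(1)[of 2] by simp
  qed measurable
qed

text \<open>The channel is exactly quadratic in \<open>w\<close>, with score
  \<open>a * e + a\<^sup>2 * w0\<close> and second derivative \<open>- a\<^sup>2\<close>. The score
  has mean \<open>a\<^sup>2 * w0\<close>, and its second moment exceeds \<open>a\<^sup>2\<close> by
  \<open>a ^ 4 * w0\<^sup>2\<close>, which is of order \<open>c\<^sup>2\<close>; so the Fisher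
  information is \<open>a\<^sup>2\<close>.\<close>

lemma (in prob_space) gauss_channel_step:
  fixes w :: "'a \<Rightarrow> real"
  assumes w[measurable]: "w \<in> borel_measurable M" and wc: "\<And>x. x \<in> space M \<Longrightarrow> \<bar>w x\<bar> \<le> c" and w0: "\<bar>w0\<bar> \<le> c"
    and a: "0 \<le> a" "a \<le> B" and B: "1 \<le> B"
  shows "\<bar>(\<integral>e. ln (\<integral>x. exp (a * e * w x + a\<^sup>2 * w0 * w x - a\<^sup>2 * (w x)\<^sup>2 / 2) \<partial>M) \<partial>std_normal_distribution)
      - a\<^sup>2 * (w0 * expectation w - (expectation w)\<^sup>2 / 2)\<bar> \<le> 40000 * B ^ 12 * c ^ 3"
proof -
  interpret N: prob_space std_normal_distribution by (rule prob_space_normal_density) simp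
  have c0: "0 \<le> c" using w0 by linarith
  note dom = gauss_channel_dominated[OF w wc w0 a c0]
  note [simp] = std_normal_moments(1)[of 1, simplified] std_normal_moments(1)[of 2]
    std_normal_moments(1)[of 4] std_normal_moments(2-4)
  have [simp]: "N.prob UNIV = 1" using N.prob_space by simp
  have aa: "a\<^sup>2 \<le> B\<^sup>2" using a by (intro power_mono)
  have BB: "B\<^sup>2 \<le> B ^ 4" "B \<le> B ^ 4" "1 \<le> B ^ 4" "B ^ 3 \<le> B ^ 12" "B ^ 4 \<le> B ^ 12"
    using B power_increasing[of 2 4 B] power_increasing[of 1 4 B] power_increasing[of 3 12 B]
      power_increasing[of 4 12 B] by auto
  show ?thesis
  proof (cases "3 * B * c \<le> 1")
    case True
    have "c \<le> 3 * B * c" using mult_right_mono[of 1 "3 * B" c] B c0 by simp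
    then have c1: "c \<le> 1" using True by linarith
    have cc: "c\<^sup>2 \<le> c" using c1 c0 by (simp add: power2_eq_square mult_left_le)
    have w0w0: "w0\<^sup>2 \<le> c\<^sup>2" using w0 by (simp add: abs_le_square_iff[symmetric] c0)
    have a4: "(a\<^sup>2)\<^sup>2 * w0\<^sup>2 \<le> B ^ 4 * c"
    proof -
      have "(a\<^sup>2)\<^sup>2 * w0\<^sup>2 \<le> (B\<^sup>2)\<^sup>2 * c" using order_trans[OF w0w0 cc] aa c0 by (intro mult_mono power_mono[of "a\<^sup>2"]) auto
      then show ?thesis by simp
    qed
    have sq: "(a * e + a\<^sup>2 * w0)\<^sup>2 = a\<^sup>2 * e\<^sup>2 + 2 * a * a\<^sup>2 * w0 * e + (a\<^sup>2)\<^sup>2 * w0\<^sup>2" for e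
      by (simp add: power2_eq_square algebra_simps)
    \<comment> \<open>Used with \<open>K = B ^ 4\<close>. As the fourth normal moment is 3, the
      majorant \<open>8 * (e ^ 4 + 81)\<close> has mean \<open>672 = 8 * (3 + 81)\<close>; and
      \<open>55 * 672 + 2\<close> is below 40000.\<close>
    have "\<bar>(\<integral>e. ln (\<integral>x. exp (a * e * w x + a\<^sup>2 * w0 * w x - a\<^sup>2 * (w x)\<^sup>2 / 2) \<partial>M) \<partial>std_normal_distribution)
      - a\<^sup>2 * (w0 * expectation w - (expectation w)\<^sup>2 / 2)\<bar> \<le> (55 * (672 * B ^ 12) + 2 * B ^ 4) * c ^ 3"
    proof (rule averaged_quadratic_expansion[where \<alpha>="\<lambda>e. a * e + a\<^sup>2 * w0" and \<beta>="\<lambda>e. - a\<^sup>2"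
        and T="\<lambda>e. B * \<bar>e\<bar> + B\<^sup>2" and E="\<lambda>e. B ^ 12 * (8 * (e ^ 4 + 81))", OF w wc dom(1)])
      show "\<bar>a * e * w x + a\<^sup>2 * w0 * w x - a\<^sup>2 * (w x)\<^sup>2 / 2 - (a * e + a\<^sup>2 * w0) * w x - - a\<^sup>2 * (w x)\<^sup>2 / 2\<bar> \<le> B ^ 4 * c ^ 3" for e x
        using c0 B by (simp add: algebra_simps)
      show "\<bar>a * e + a\<^sup>2 * w0\<bar> \<le> B * \<bar>e\<bar> + B\<^sup>2" for e
      proof -
        have "\<bar>a * e\<bar> \<le> B * \<bar>e\<bar>" unfolding abs_mult using a by (intro mult_right_mono) auto
        moreover have "\<bar>a\<^sup>2 * w0\<bar> \<le> B\<^sup>2 * 1" unfolding abs_mult using aa w0 c1 by (intro mult_mono) auto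
        ultimately show ?thesis by linarith
      qed
      show "\<bar>- a\<^sup>2\<bar> \<le> B ^ 4" using aa BB by simp
      show "(B * \<bar>e\<bar> + B\<^sup>2 + 2 * B ^ 4) ^ 3 \<le> B ^ 12 * (8 * (e ^ 4 + 81))" for e
      proof -
        have "B * \<bar>e\<bar> \<le> B ^ 4 * \<bar>e\<bar>" using BB by (intro mult_right_mono) auto
        then have "(B * \<bar>e\<bar> + B\<^sup>2 + 2 * B ^ 4) ^ 3 \<le> (B ^ 4 * (\<bar>e\<bar> + 3)) ^ 3"
          using B BB by (intro power_mono) (auto simp: algebra_simps)
        also have "\<dots> = B ^ 12 * (\<bar>e\<bar> + 3) ^ 3" by (simp add: power_mult_distrib)
        also have "\<dots> \<le> B ^ 12 * (8 * (e ^ 4 + 81))"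
        proof (rule mult_left_mono)
          \<comment> \<open>The base is at least 1, so the cube may be raised to the fourth power;
            then \<open>(p + q)\<^sup>2 \<le> 2 * (p\<^sup>2 + q\<^sup>2)\<close> is applied twice.
            Only an even moment of the noise remains.\<close>
          have "(\<bar>e\<bar> + 3) ^ 3 \<le> (\<bar>e\<bar> + 3) ^ 4" by (rule power_increasing) auto
          also have "(\<bar>e\<bar> + 3) ^ 4 = ((\<bar>e\<bar> + 3)\<^sup>2)\<^sup>2" by simp
          also have "\<dots> \<le> (2 * (\<bar>e\<bar>\<^sup>2 + 9))\<^sup>2"
            using zero_le_power2[of "\<bar>e\<bar> - 3"] by (intro power_mono) (auto simp: power2_eq_square algebra_simps)
          also have "\<dots> \<le> 8 * ((\<bar>e\<bar>\<^sup>2)\<^sup>2 + 81)"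
            using zero_le_power2[of "\<bar>e\<bar>\<^sup>2 - 9"] by (simp add: power2_eq_square algebra_simps)
          finally show "(\<bar>e\<bar> + 3) ^ 3 \<le> 8 * (e ^ 4 + 81)" by simp
        qed (use B in simp)
        finally show ?thesis .
      qed
      show "\<bar>(\<integral>e. a * e + a\<^sup>2 * w0 \<partial>std_normal_distribution) - w0 * a\<^sup>2\<bar> \<le> B ^ 4 * c\<^sup>2"
        using B by simp
      show "\<bar>(\<integral>e. - a\<^sup>2 + (a * e + a\<^sup>2 * w0)\<^sup>2 \<partial>std_normal_distribution)\<bar> \<le> B ^ 4 * c"
        unfolding sq using a4 by simp
      show "\<bar>(\<integral>e. (a * e + a\<^sup>2 * w0)\<^sup>2 \<partial>std_normal_distribution) - a\<^sup>2\<bar> \<le> B ^ 4 * c"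
        unfolding sq using a4 by simp
    qed (use c1 BB in \<open>auto simp: sq\<close>)
    also have "\<dots> \<le> (40000 * B ^ 12) * c ^ 3" using BB c0 by (intro mult_right_mono) auto
    finally show ?thesis .
  next
    case False
    then have c3: "c \<le> 9 * B\<^sup>2 * c ^ 3" "c\<^sup>2 \<le> 3 * B * c ^ 3"
      using cube_dominates_lower_powers[OF B] by auto
    have "\<bar>(\<integral>e. ln (\<integral>x. exp (a * e * w x + a\<^sup>2 * w0 * w x - a\<^sup>2 * (w x)\<^sup>2 / 2) \<partial>M) \<partial>std_normal_distribution)
      - a\<^sup>2 * (w0 * expectation w - (expectation w)\<^sup>2 / 2)\<bar> \<le> (B * c + 3 / 2 * B\<^sup>2 * c\<^sup>2) + 3 / 2 * a\<^sup>2 * c\<^sup>2"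
      by (rule coarse_log_expansion[OF w wc w0 dom(1) _ _ dom(2)]) auto
    also have "\<dots> \<le> B * c + 3 * B\<^sup>2 * c\<^sup>2"
      using mult_right_mono[OF aa, of "c\<^sup>2"] by simp
    also have "\<dots> \<le> B * (9 * B\<^sup>2 * c ^ 3) + 3 * B\<^sup>2 * (3 * B * c ^ 3)"
      using c3 B by (intro add_mono mult_left_mono) auto
    also have "\<dots> = 18 * B ^ 3 * c ^ 3" by (simp add: power2_eq_square power3_eq_cube)
    also have "\<dots> \<le> 40000 * B ^ 12 * c ^ 3" using BB c0 B by (intro mult_right_mono) auto
    finally show ?thesis .
  qed
qed

section \<open>The likelihood channel\<close>

lemma likelihood_ratio_expansion:
  fixes u z \<alpha> \<beta> B :: real
  assumes u: "\<bar>u - \<alpha> * z - \<beta> * z\<^sup>2 / 2\<bar> \<le> B * \<bar>z\<bar> ^ 3" and ab: "\<bar>\<alpha>\<bar> \<le> B" "\<bar>\<beta>\<bar> \<le> B"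
    and B: "1 \<le> B" and z: "3 * B * \<bar>z\<bar> \<le> 1"
  shows "\<bar>exp u - 1\<bar> \<le> 9 * B * \<bar>z\<bar>" "\<bar>exp u - 1 - \<alpha> * z\<bar> \<le> 15 * B\<^sup>2 * z\<^sup>2"
    "\<bar>exp u - 1 - \<alpha> * z - (\<beta> + \<alpha>\<^sup>2) * z\<^sup>2 / 2\<bar> \<le> 27 * B ^ 3 * \<bar>z\<bar> ^ 3"
proof -
  \<comment> \<open>All terms are measured in powers of \<open>t\<close>, which dominates
    \<open>\<bar>z\<bar>\<close> because \<open>B \<ge> 1\<close> and is at most 1/3.\<close>
  define t where "t = B * \<bar>z\<bar>"
  have t: "0 \<le> t" "t \<le> 1 / 3" using B z by (auto simp: t_def)
  have zt: "\<bar>z\<bar> \<le> t" using mult_right_mono[OF B, of "\<bar>z\<bar>"] by (simp add: t_def)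
  then have z3: "\<bar>z\<bar> \<le> 1 / 3" using t by linarith
  have tt: "B * z\<^sup>2 \<le> t\<^sup>2" "B * z\<^sup>2 \<le> t / 3" "B * \<bar>z\<bar> ^ 3 \<le> B * z\<^sup>2 / 3" "B * \<bar>z\<bar> ^ 3 \<le> t ^ 3"
  proof -
    have zz: "z\<^sup>2 = \<bar>z\<bar> * \<bar>z\<bar>" by (simp add: power2_eq_square)
    show "B * z\<^sup>2 \<le> t\<^sup>2" using mult_left_mono[OF zt t(1)] by (simp add: t_def zz power2_eq_square mult_ac)
    show "B * z\<^sup>2 \<le> t / 3" using mult_left_mono[OF z3 t(1)] by (simp add: t_def zz mult_ac)
    show "B * \<bar>z\<bar> ^ 3 \<le> B * z\<^sup>2 / 3"
      using mult_left_mono[OF z3, of "B * z\<^sup>2"] B by (simp add: zz power3_eq_cube mult_ac)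
    have "B * 1 \<le> B ^ 3" using power_increasing[of 1 3 B] B by simp
    then show "B * \<bar>z\<bar> ^ 3 \<le> t ^ 3" unfolding t_def power_mult_distrib by (intro mult_right_mono) auto
  qed
  have az: "\<bar>\<alpha> * z\<bar> \<le> t" unfolding abs_mult t_def using ab by (intro mult_right_mono) auto
  have bz: "\<bar>\<beta> * z\<^sup>2\<bar> \<le> B * z\<^sup>2" unfolding abs_mult using ab by (auto intro: mult_right_mono)
  have r: "\<bar>u - \<alpha> * z\<bar> \<le> B * z\<^sup>2" using u bz tt by linarith
  have ut: "\<bar>u\<bar> \<le> 2 * t" using r az tt t by linarith
  then have u1: "\<bar>u\<bar> \<le> 1" using t by linarith
  have e: "\<bar>exp u - 1 - u - u\<^sup>2 / 2\<bar> \<le> 3 * \<bar>u\<bar> ^ 3" by (rule exp_taylor_bound[OF u1])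
  have u2: "u\<^sup>2 \<le> 4 * t\<^sup>2" using power_mono[OF ut, of 2] by (simp add: power_mult_distrib)
  have u3: "\<bar>u\<bar> ^ 3 \<le> 8 * t ^ 3" using power_mono[OF ut, of 3] by (simp add: power_mult_distrib)
  have ts: "t\<^sup>2 \<le> t / 3" "t ^ 3 \<le> t\<^sup>2 / 3"
    using mult_left_mono[OF t(2,1)] mult_left_mono[OF t(2), of "t * t"]
    by (simp_all add: power2_eq_square power3_eq_cube)
  \<comment> \<open>Each truncation of the likelihood ratio \<open>exp u\<close> has its own use:
    the first bounds the change of an average when the data are drawn at the true overlap instead of
    0, the second yields the mean of the score there, the third the score identities at 0.\<close>
  show "\<bar>exp u - 1\<bar> \<le> 9 * B * \<bar>z\<bar>"
  proof -
    have "9 * B * \<bar>z\<bar> = 9 * t" by (simp add: t_def)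
    moreover have "0 \<le> u\<^sup>2" by simp
    ultimately show ?thesis using e u2 u3 ut ts t by linarith
  qed
  show "\<bar>exp u - 1 - \<alpha> * z\<bar> \<le> 15 * B\<^sup>2 * z\<^sup>2"
  proof -
    have "15 * B\<^sup>2 * z\<^sup>2 = 15 * t\<^sup>2" by (simp add: t_def power_mult_distrib)
    moreover have "0 \<le> u\<^sup>2" by simp
    ultimately show ?thesis using e u2 u3 ts r tt by linarith
  qed
  have "\<bar>u\<^sup>2 - \<alpha>\<^sup>2 * z\<^sup>2\<bar> = \<bar>u - \<alpha> * z\<bar> * \<bar>u + \<alpha> * z\<bar>"
    by (simp add: abs_mult[symmetric] power2_eq_square algebra_simps)
  also have "\<dots> \<le> t\<^sup>2 * (3 * t)" using r tt az ut by (intro mult_mono) auto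
  also have "\<dots> = 3 * t ^ 3" by (simp add: power2_eq_square power3_eq_cube)
  finally have s: "\<bar>u\<^sup>2 - \<alpha>\<^sup>2 * z\<^sup>2\<bar> \<le> 3 * t ^ 3" .
  \<comment> \<open>\<open>p\<close>, \<open>q\<close> and \<open>r\<close> stand for the remainders
    of exp, of \<open>u\<close> and of \<open>u\<^sup>2\<close>; \<open>3 * 8 + 1 + 3 / 2\<close> is
    below 27.\<close>
  have tri: "\<bar>p + q + r / 2\<bar> \<le> 27 * s"
    if "\<bar>p\<bar> \<le> 3 * x" "\<bar>q\<bar> \<le> y" "\<bar>r\<bar> \<le> 3 * s" "x \<le> 8 * s" "y \<le> s" "0 \<le> s" for p q r s x y :: real
    using that by linarith
  have "exp u - 1 - \<alpha> * z - (\<beta> + \<alpha>\<^sup>2) * z\<^sup>2 / 2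
    = (exp u - 1 - u - u\<^sup>2 / 2) + (u - \<alpha> * z - \<beta> * z\<^sup>2 / 2) + (u\<^sup>2 - \<alpha>\<^sup>2 * z\<^sup>2) / 2"
    by (simp add: field_simps)
  moreover have "27 * B ^ 3 * \<bar>z\<bar> ^ 3 = 27 * t ^ 3" by (simp add: t_def power_mult_distrib)
  moreover have "0 \<le> t ^ 3" using t by simp
  ultimately show "\<bar>exp u - 1 - \<alpha> * z - (\<beta> + \<alpha>\<^sup>2) * z\<^sup>2 / 2\<bar> \<le> 27 * B ^ 3 * \<bar>z\<bar> ^ 3"
    by (simp only: tri[OF e u s u3 tt(4)])
qed

lemma eq_zero_if_abs_le_linear:
  fixes a R \<delta> :: real
  assumes "0 < \<delta>" and le: "\<And>z. 0 < z \<Longrightarrow> z \<le> \<delta> \<Longrightarrow> \<bar>a\<bar> \<le> R * z"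
  shows "a = 0"
proof (rule ccontr)
  assume "a \<noteq> 0"
  define z where "z = min \<delta> (\<bar>a\<bar> / (2 * (\<bar>R\<bar> + 1)))"
  have "0 < z" "z \<le> \<delta>" using assms(1) \<open>a \<noteq> 0\<close> by (auto simp: z_def)
  then have "\<bar>a\<bar> \<le> R * z" by (rule le)
  also have "\<dots> \<le> (\<bar>R\<bar> + 1) * (\<bar>a\<bar> / (2 * (\<bar>R\<bar> + 1)))"
    using \<open>0 < z\<close> by (intro mult_mono) (auto simp: z_def)
  also have "\<dots> = \<bar>a\<bar> / 2" by (simp add: field_simps)
  finally show False using \<open>a \<noteq> 0\<close> by simp
qed

text \<open>Instead of differentiating the normalisation twice under the integral, the pointwise
  expansion of \<open>exp (u y z)\<close> is integrated:
  \<open>a * z + b * z\<^sup>2 / 2 = O(z ^ 3)\<close> for all small \<open>z > 0\<close> forces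
  first \<open>a = 0\<close> and then \<open>b = 0\<close>.\<close>

lemma (in prob_space) score_identities:
  fixes u :: "'a \<Rightarrow> real \<Rightarrow> real" and \<alpha> \<beta> :: "'a \<Rightarrow> real"
  assumes u: "\<And>z. (\<lambda>y. u y z) \<in> borel_measurable M"
    and [measurable]: "\<alpha> \<in> borel_measurable M" "\<beta> \<in> borel_measurable M"
    and ab: "\<And>y. y \<in> space M \<Longrightarrow> \<bar>\<alpha> y\<bar> \<le> B" "\<And>y. y \<in> space M \<Longrightarrow> \<bar>\<beta> y\<bar> \<le> B"
    and expand: "\<And>y z. y \<in> space M \<Longrightarrow> \<bar>z\<bar> \<le> c \<Longrightarrow> \<bar>u y z - \<alpha> y * z - \<beta> y * z\<^sup>2 / 2\<bar> \<le> B * \<bar>z\<bar> ^ 3"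
    and norm: "\<And>z. \<bar>z\<bar> \<le> c \<Longrightarrow> expectation (\<lambda>y. exp (u y z)) = 1"
    and B: "1 \<le> B" and c: "0 < c"
  shows "expectation \<alpha> = 0" "expectation (\<lambda>y. \<beta> y + (\<alpha> y)\<^sup>2) = 0"
proof -
  note [measurable] = u
  define a b where "a = expectation \<alpha>" "b = expectation (\<lambda>y. \<beta> y + (\<alpha> y)\<^sup>2)"
  define \<delta> where "\<delta> = min c (1 / (3 * B))"
  have \<delta>: "0 < \<delta>" using B c by (simp add: \<delta>_def)
  have a2: "\<bar>(\<alpha> y)\<^sup>2\<bar> \<le> B\<^sup>2" if "y \<in> space M" for y
    using ab(1)[OF that] B by (simp add: abs_le_square_iff[symmetric])
  have i[simp]: "integrable M \<alpha>" "integrable M \<beta>" "integrable M (\<lambda>y. (\<alpha> y)\<^sup>2)"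
    by (rule abs_expectation_le(1)[OF _ ab(1)] abs_expectation_le(1)[OF _ ab(2)]
      abs_expectation_le(1)[OF _ a2]; measurable)+
  have main: "\<bar>a * z + b * z\<^sup>2 / 2\<bar> \<le> 27 * B ^ 3 * z ^ 3" if z: "0 < z" "z \<le> \<delta>" for z
  proof -
    have zc: "\<bar>z\<bar> \<le> c" and zB: "3 * B * \<bar>z\<bar> \<le> 1" using z B by (auto simp: \<delta>_def field_simps)
    \<comment> \<open>An integral with value 1 cannot be the default 0 of a non-integrable
      function.\<close>
    have "expectation (\<lambda>y. exp (u y z)) \<noteq> 0" using norm[OF zc] by simp
    then have iu: "integrable M (\<lambda>y. exp (u y z))" using not_integrable_integral_eq by blast
    have "expectation (\<lambda>y. exp (u y z) - 1 - \<alpha> y * z - (\<beta> y + (\<alpha> y)\<^sup>2) * z\<^sup>2 / 2) = - (a * z + b * z\<^sup>2 / 2)"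
      using iu norm[OF zc] by (simp add: a_b_def prob_space)
    moreover have "\<bar>expectation (\<lambda>y. exp (u y z) - 1 - \<alpha> y * z - (\<beta> y + (\<alpha> y)\<^sup>2) * z\<^sup>2 / 2)\<bar> \<le> 27 * B ^ 3 * \<bar>z\<bar> ^ 3"
      by (rule abs_expectation_le(2)[OF _ likelihood_ratio_expansion(3)[OF expand[OF _ zc] ab B zB]]) measurable
    ultimately show ?thesis using z by simp
  qed
  have zB: "0 \<le> 27 * B ^ 3" using B by simp
  show a0: "expectation \<alpha> = 0" unfolding a_b_def(1)[symmetric]
  proof (rule eq_zero_if_abs_le_linear[OF \<delta>])
    fix z assume z: "0 < z" "z \<le> \<delta>"
    have "\<bar>a\<bar> * z = \<bar>a * z\<bar>" using z by (simp add: abs_mult)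
    also have "\<dots> \<le> \<bar>a * z + b * z\<^sup>2 / 2\<bar> + \<bar>b * z\<^sup>2 / 2\<bar>" by linarith
    also have "\<dots> \<le> 27 * B ^ 3 * z ^ 3 + \<bar>b\<bar> / 2 * z\<^sup>2" using main[OF z] by (simp add: abs_mult)
    also have "\<dots> \<le> 27 * B ^ 3 * (\<delta> * z\<^sup>2) + \<bar>b\<bar> / 2 * z\<^sup>2"
      using z zB by (intro add_right_mono mult_left_mono) (simp_all add: power2_eq_square power3_eq_cube mult_right_mono)
    also have "\<dots> = (27 * B ^ 3 * \<delta> + \<bar>b\<bar> / 2) * z * z" by (simp add: power2_eq_square algebra_simps)
    finally show "\<bar>a\<bar> \<le> (27 * B ^ 3 * \<delta> + \<bar>b\<bar> / 2) * z" using z by simp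
  qed
  show "expectation (\<lambda>y. \<beta> y + (\<alpha> y)\<^sup>2) = 0" unfolding a_b_def(2)[symmetric]
  proof (rule eq_zero_if_abs_le_linear[OF \<delta>])
    fix z assume z: "0 < z" "z \<le> \<delta>"
    have "\<bar>b\<bar> * z\<^sup>2 = 2 * \<bar>a * z + b * z\<^sup>2 / 2\<bar>" using a0 by (simp add: a_b_def(1) abs_mult)
    also have "\<dots> \<le> 54 * B ^ 3 * z * z\<^sup>2" using main[OF z] by (simp add: power2_eq_square power3_eq_cube)
    finally show "\<bar>b\<bar> \<le> 54 * B ^ 3 * z" using z by simp
  qed
qed

text \<open>\<open>P\<close> is the data law at overlap 0 and \<open>Q\<close> the law at the true
  overlap \<open>w0\<close>, so averages under \<open>Q\<close> are averages under \<open>P\<close>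
  weighted by the likelihood ratio. To first order this gives the score the mean
  \<open>w0 * I\<close>, while the second order averages move only by order \<open>c\<close>; the
  identities at 0 carry over with admissible errors.\<close>

lemma (in prob_space) llh_channel_step:
  fixes w :: "'a \<Rightarrow> real" and u :: "'d \<Rightarrow> real \<Rightarrow> real" and \<alpha> \<beta> :: "'d \<Rightarrow> real"
  assumes w[measurable]: "w \<in> borel_measurable M" and wc: "\<And>x. x \<in> space M \<Longrightarrow> \<bar>w x\<bar> \<le> c" and w0: "\<bar>w0\<bar> \<le> c"
    and P: "prob_space P" and u[measurable]: "(\<lambda>(y, z). u y z) \<in> borel_measurable (P \<Otimes>\<^sub>M borel)"
    and \<alpha>\<beta>[measurable]: "\<alpha> \<in> borel_measurable P" "\<beta> \<in> borel_measurable P"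
    and ab: "\<And>y. y \<in> space P \<Longrightarrow> \<bar>\<alpha> y\<bar> \<le> B" "\<And>y. y \<in> space P \<Longrightarrow> \<bar>\<beta> y\<bar> \<le> B"
    and expand: "\<And>y z. y \<in> space P \<Longrightarrow> \<bar>z\<bar> \<le> c \<Longrightarrow> \<bar>u y z - \<alpha> y * z - \<beta> y * z\<^sup>2 / 2\<bar> \<le> B * \<bar>z\<bar> ^ 3"
    and norm: "\<And>z. \<bar>z\<bar> \<le> c \<Longrightarrow> (\<integral>y. exp (u y z) \<partial>P) = 1"
    and Q: "Q = density P (\<lambda>y. ennreal (exp (u y w0)))" and I: "I = (\<integral>y. (\<alpha> y)\<^sup>2 \<partial>P)"
    and B: "1 \<le> B" and c: "0 < c"
  shows "\<bar>(\<integral>y. ln (\<integral>x. exp (u y (w x)) \<partial>M) \<partial>Q) - I * (w0 * expectation w - (expectation w)\<^sup>2 / 2)\<bar>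
      \<le> 7000000 * B ^ 12 * c ^ 3"
proof -
  interpret P: prob_space P by (rule P)
  have um[measurable]: "(\<lambda>y. u y z) \<in> borel_measurable P" for z by measurable
  have iu: "integrable P (\<lambda>y. exp (u y w0))"
    using norm[OF w0] not_integrable_integral_eq[of P "\<lambda>y. exp (u y w0)"] by force
  have sQ: "sets Q = sets P" and spQ: "space Q = space P" by (simp_all add: Q)
  have "emeasure Q (space Q) = ennreal (\<integral>y. exp (u y w0) \<partial>P)"
    unfolding Q using iu
    by (subst emeasure_density, simp, simp, subst nn_integral_eq_integral[symmetric])
      (auto intro!: nn_integral_cong simp: indicator_def)
  then have "prob_space Q" using norm[OF w0] by (intro prob_spaceI) simp
  then interpret Q: prob_space Q .
  have intQ: "(\<integral>y. f y \<partial>Q) = (\<integral>y. exp (u y w0) * f y \<partial>P)" if "f \<in> borel_measurable P" for f :: "'d \<Rightarrow> real"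
    unfolding Q using that by (subst integral_density) auto
  have [measurable_cong]: "sets Q = sets P" by (rule sQ)
  \<comment> \<open>This bound on the increment holds for every \<open>c\<close>, small or not, and
    so also serves the coarse case.\<close>
  define s where "s = B * c + B * c\<^sup>2 / 2 + B * c ^ 3"
  have us: "\<bar>u y (w x)\<bar> \<le> s" if "y \<in> space Q" "x \<in> space M" for y x
  proof -
    have y: "y \<in> space P" using that by (simp add: spQ)
    have "\<bar>\<alpha> y * w x\<bar> \<le> B * c" unfolding abs_mult using ab(1)[OF y] wc[OF that(2)] B by (intro mult_mono) auto
    moreover have "\<bar>\<beta> y * (w x)\<^sup>2\<bar> \<le> B * c\<^sup>2"
      unfolding abs_mult[of "\<beta> y"] using ab(2)[OF y] wc[OF that(2)] B c by (intro mult_mono) (auto simp: abs_le_square_iff[symmetric])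
    moreover have "B * \<bar>w x\<bar> ^ 3 \<le> B * c ^ 3"
      using wc[OF that(2)] B by (intro mult_left_mono power_mono) auto
    ultimately show ?thesis using expand[OF y wc[OF that(2)]] unfolding s_def by linarith
  qed
  have dom: "dominated_channel M Q (\<lambda>y x. u y (w x))"
    by (rule dominated_channelI[OF Q.prob_space_axioms _ _ us]) measurable
  have a2: "\<bar>(\<alpha> y)\<^sup>2\<bar> \<le> B\<^sup>2" if "y \<in> space P" for y
    using ab(1)[OF that] B by (simp add: abs_le_square_iff[symmetric])
  have b2: "\<bar>\<beta> y + (\<alpha> y)\<^sup>2\<bar> \<le> 2 * B\<^sup>2" if "y \<in> space P" for y
  proof -
    have "B \<le> B\<^sup>2" using power_increasing[of 1 2 B] B by simp
    then show ?thesis using ab(2)[OF that] a2[OF that] by linarith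
  qed
  have iP: "integrable P \<alpha>" "integrable P \<beta>" "integrable P (\<lambda>y. (\<alpha> y)\<^sup>2)"
    by (rule P.abs_expectation_le(1)[OF _ ab(1)] P.abs_expectation_le(1)[OF _ ab(2)]
      P.abs_expectation_le(1)[OF _ a2]; measurable)+
  have iQ: "integrable Q \<alpha>" "integrable Q \<beta>" "integrable Q (\<lambda>y. (\<alpha> y)\<^sup>2)"
    by (rule Q.abs_expectation_le(1)[OF _ ab(1)] Q.abs_expectation_le(1)[OF _ ab(2)]
      Q.abs_expectation_le(1)[OF _ a2]; simp add: spQ; measurable)+
  have iPu: "integrable P (\<lambda>y. exp (u y w0) * f y)" if "integrable Q f" for f :: "'d \<Rightarrow> real"
  proof -
    have "f \<in> borel_measurable P" using borel_measurable_integrable[OF that] by (simp add: Q)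
    then show ?thesis using that unfolding Q by (subst (asm) integrable_density) auto
  qed
  have I0: "0 \<le> I" "I \<le> B\<^sup>2"
    using P.abs_expectation_le(2)[OF _ a2] unfolding I by auto
  have B3: "B ^ 3 \<le> B ^ 12" "B ^ 9 \<le> B ^ 12" "B \<le> B ^ 3" "B\<^sup>2 \<le> B ^ 3" "1 \<le> B ^ 3"
    using B power_increasing[of 1 3 B] power_increasing[of 2 3 B] power_increasing[of 3 12 B]
      power_increasing[of 9 12 B] by auto
  show ?thesis
  proof (cases "3 * B * c \<le> 1")
    case True
    have "c \<le> 3 * B * c" using mult_right_mono[of 1 "3 * B" c] B c by simp
    then have c1: "c \<le> 1" using True by linarith
    have "3 * B * \<bar>w0\<bar> \<le> 3 * B * c" using w0 B by (intro mult_left_mono) auto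
    then have zB: "3 * B * \<bar>w0\<bar> \<le> 1" using True by linarith
    have w0w0: "w0\<^sup>2 \<le> c\<^sup>2" using w0 c by (simp add: abs_le_square_iff[symmetric])
    note lr = likelihood_ratio_expansion[OF expand[OF _ w0] ab B zB]
    note score = P.score_identities[OF um \<alpha>\<beta> ab expand norm B c]
    have diff: "\<bar>(\<integral>y. f y \<partial>Q) - (\<integral>y. f y \<partial>P)\<bar> \<le> F * (9 * B * c)"
      if f[measurable]: "f \<in> borel_measurable P" and fF: "\<And>y. y \<in> space P \<Longrightarrow> \<bar>f y\<bar> \<le> F"
        and i: "integrable P f" "integrable Q f" for f :: "'d \<Rightarrow> real" and F
    proof -
      have "(\<integral>y. f y \<partial>Q) - (\<integral>y. f y \<partial>P) = (\<integral>y. f y * (exp (u y w0) - 1) \<partial>P)"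
        unfolding intQ[OF f] using i(1) iPu[OF i(2)] by (simp add: algebra_simps)
      also have "\<bar>\<dots>\<bar> \<le> F * (9 * B * c)"
      proof (rule P.abs_expectation_le(2))
        fix y assume y: "y \<in> space P"
        have "\<bar>exp (u y w0) - 1\<bar> \<le> 9 * B * c"
          using lr(1)[OF y y y] w0 B by (intro order_trans[OF lr(1)[OF y y y]] mult_left_mono) auto
        then show "\<bar>f y * (exp (u y w0) - 1)\<bar> \<le> F * (9 * B * c)"
          unfolding abs_mult using fF[OF y] by (intro mult_mono) auto
      qed measurable
      finally show ?thesis .
    qed
    \<comment> \<open>\<open>K = 24 * B ^ 3\<close> covers the errors with factors 15, 18 and 9
      found below, and with \<open>T = B\<close> it makes \<open>T + 2 * K \<le> 49 * B ^ 3\<close>.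
      Finally \<open>55 * 49 ^ 3 + 48\<close> is below 7000000.\<close>
    have "\<bar>(\<integral>y. ln (\<integral>x. exp (u y (w x)) \<partial>M) \<partial>Q) - I * (w0 * expectation w - (expectation w)\<^sup>2 / 2)\<bar>
      \<le> (55 * (49 * B ^ 3) ^ 3 + 2 * (24 * B ^ 3)) * c ^ 3"
    proof (rule averaged_quadratic_expansion[where \<alpha>=\<alpha> and \<beta>=\<beta> and T="\<lambda>_. B"
        and E="\<lambda>_. (49 * B ^ 3) ^ 3", OF w wc dom iQ(1,3,2)])
      fix y x assume y': "y \<in> space Q" and x: "x \<in> space M"
      then have y: "y \<in> space P" by (simp add: spQ)
      have "B * \<bar>w x\<bar> ^ 3 \<le> (24 * B ^ 3) * c ^ 3"
        using wc[OF x] B B3 by (intro mult_mono power_mono) auto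
      then show "\<bar>u y (w x) - \<alpha> y * w x - \<beta> y * (w x)\<^sup>2 / 2\<bar> \<le> 24 * B ^ 3 * c ^ 3"
        using expand[OF y wc[OF x]] by linarith
    next
      \<comment> \<open>The two lowest orders of the likelihood ratio can be subtracted: under
        \<open>P\<close>, order zero contributes the mean score 0 and order one contributes
        \<open>w0 * I\<close>.\<close>
      have "(\<integral>y. \<alpha> y \<partial>Q) - w0 * I = (\<integral>y. \<alpha> y * (exp (u y w0) - 1 - \<alpha> y * w0) \<partial>P)"
        unfolding intQ[OF \<alpha>\<beta>(1)] I using iP iPu[OF iQ(1)] score(1)
        by (simp add: algebra_simps power2_eq_square[symmetric])
      also have "\<bar>\<dots>\<bar> \<le> B * (15 * B\<^sup>2 * c\<^sup>2)"
      proof (rule P.abs_expectation_le(2))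
        fix y assume y: "y \<in> space P"
        have "\<bar>exp (u y w0) - 1 - \<alpha> y * w0\<bar> \<le> 15 * B\<^sup>2 * c\<^sup>2"
          using w0w0 B by (intro order_trans[OF lr(2)[OF y y y]] mult_left_mono) auto
        then show "\<bar>\<alpha> y * (exp (u y w0) - 1 - \<alpha> y * w0)\<bar> \<le> B * (15 * B\<^sup>2 * c\<^sup>2)"
          unfolding abs_mult using ab(1)[OF y] by (intro mult_mono) auto
      qed measurable
      also have "\<dots> = 15 * B ^ 3 * c\<^sup>2" by (simp add: power2_eq_square power3_eq_cube)
      also have "\<dots> \<le> 24 * B ^ 3 * c\<^sup>2" using B by (intro mult_right_mono) auto
      finally show "\<bar>(\<integral>y. \<alpha> y \<partial>Q) - w0 * I\<bar> \<le> 24 * B ^ 3 * c\<^sup>2" .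
    next
      have "\<bar>(\<integral>y. \<beta> y + (\<alpha> y)\<^sup>2 \<partial>Q) - (\<integral>y. \<beta> y + (\<alpha> y)\<^sup>2 \<partial>P)\<bar> \<le> 2 * B\<^sup>2 * (9 * B * c)"
        by (rule diff[OF _ b2]) (use iP iQ in auto)
      also have "\<dots> = 18 * B ^ 3 * c" by (simp add: power2_eq_square power3_eq_cube)
      also have "\<dots> \<le> 24 * B ^ 3 * c" using B c by (intro mult_right_mono) auto
      finally show "\<bar>(\<integral>y. \<beta> y + (\<alpha> y)\<^sup>2 \<partial>Q)\<bar> \<le> 24 * B ^ 3 * c" using score(2) by simp
    next
      have "\<bar>(\<integral>y. (\<alpha> y)\<^sup>2 \<partial>Q) - I\<bar> \<le> B\<^sup>2 * (9 * B * c)"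
        unfolding I by (rule diff[OF _ a2]) (use iP iQ in auto)
      also have "\<dots> = 9 * B ^ 3 * c" by (simp add: power2_eq_square power3_eq_cube)
      also have "\<dots> \<le> 24 * B ^ 3 * c" using B c by (intro mult_right_mono) auto
      finally show "\<bar>(\<integral>y. (\<alpha> y)\<^sup>2 \<partial>Q) - I\<bar> \<le> 24 * B ^ 3 * c" .
    next
      show "\<bar>\<beta> d\<bar> \<le> 24 * B ^ 3" if "d \<in> space Q" for d
        using ab(2)[of d] that B3 B by (simp add: spQ)
      show "(B + 2 * (24 * B ^ 3)) ^ 3 \<le> (49 * B ^ 3) ^ 3" using B3 B by (intro power_mono) auto
    qed (use c1 B3 ab(1) spQ Q.prob_space in auto)
    also have "\<dots> \<le> (7000000 * B ^ 12) * c ^ 3"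
      using B3 c by (intro mult_right_mono) (auto simp: power_mult_distrib)
    finally show ?thesis .
  next
    case False
    then have c3: "c \<le> 9 * B\<^sup>2 * c ^ 3" "c\<^sup>2 \<le> 3 * B * c ^ 3"
      using cube_dominates_lower_powers[OF B] by auto
    have "\<bar>(\<integral>y. ln (\<integral>x. exp (u y (w x)) \<partial>M) \<partial>Q) - I * (w0 * expectation w - (expectation w)\<^sup>2 / 2)\<bar>
      \<le> s + 3 / 2 * I * c\<^sup>2"
      by (rule coarse_log_expansion[OF w wc w0 dom _ _ us I0(1)]) (auto simp: Q.prob_space)
    also have "\<dots> \<le> B * c + 2 * B\<^sup>2 * c\<^sup>2 + B * c ^ 3"
      using mult_right_mono[OF I0(2), of "c\<^sup>2"] mult_right_mono[OF power_increasing[of 1 2 B], of "c\<^sup>2"] B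
      by (simp add: s_def)
    also have "\<dots> \<le> B * (9 * B\<^sup>2 * c ^ 3) + 2 * B\<^sup>2 * (3 * B * c ^ 3) + B ^ 3 * c ^ 3"
      using c3 B B3 c by (intro add_mono mult_left_mono mult_right_mono) auto
    also have "\<dots> = 16 * B ^ 3 * c ^ 3" by (simp add: power2_eq_square power3_eq_cube)
    also have "\<dots> \<le> 7000000 * B ^ 12 * c ^ 3" using B3 c B by (intro mult_right_mono) auto
    finally show ?thesis .
  qed
qed

section \<open>Measurability in the true configuration and in the data\<close>

lemma measurable_PiM_kernel:
  fixes K :: "'p \<Rightarrow> 'x \<Rightarrow> 'd measure"
  assumes A: "finite A" and K: "\<And>p. p \<in> A \<Longrightarrow> K p \<in> N \<rightarrow>\<^sub>M prob_algebra (S p)"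
  shows "(\<lambda>x. Pi\<^sub>M A (\<lambda>p. K p x)) \<in> N \<rightarrow>\<^sub>M prob_algebra (Pi\<^sub>M A S)"
proof (rule measurable_prob_algebra_generated[OF sets_PiM Int_stable_prod_algebra prod_algebra_sets_into_space])
  have Kx: "prob_space (K p x)" "sets (K p x) = sets (S p)" if "p \<in> A" "x \<in> space N" for p x
    using measurable_space[OF K[OF that(1)] that(2)] by (auto simp: space_prob_algebra)
  show "prob_space (Pi\<^sub>M A (\<lambda>p. K p x))" if "x \<in> space N" for x
    using that by (intro prob_space_PiM Kx)
  show "sets (Pi\<^sub>M A (\<lambda>p. K p x)) = sets (Pi\<^sub>M A S)" if "x \<in> space N" for x
    using that by (intro sets_PiM_cong Kx) auto
  fix X assume "X \<in> prod_algebra A S"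
  then obtain E where X: "X = Pi\<^sub>E A E" and E: "\<And>p. p \<in> A \<Longrightarrow> E p \<in> sets (S p)"
    by (elim prod_algebraE_all) auto
  have "emeasure (Pi\<^sub>M A (\<lambda>p. K p x)) X = (\<Prod>p\<in>A. emeasure (K p x) (E p))" if x: "x \<in> space N" for x
  proof -
    \<comment> \<open>The interpretation of \<open>product_prob_space\<close> asks for a probability
      measure at every index; a point mass fills the indices outside \<open>A\<close>, which the
      product ignores.\<close>
    define K' where "K' p = (if p \<in> A then K p x else return (count_space UNIV) undefined)" for p
    have "prob_space (K' p)" for p using Kx x by (auto simp: K'_def prob_space_return)
    then interpret K': product_prob_space K' by (rule product_prob_spaceI)
    have "Pi\<^sub>M A (\<lambda>p. K p x) = Pi\<^sub>M A K'" by (intro PiM_cong) (auto simp: K'_def)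
    then have "emeasure (Pi\<^sub>M A (\<lambda>p. K p x)) X = (\<Prod>p\<in>A. emeasure (K' p) (E p))"
      unfolding X using E Kx x by (simp, intro K'.emeasure_PiM A) (auto simp: K'_def)
    then show ?thesis by (simp add: K'_def)
  qed
  moreover have "(\<lambda>x. \<Prod>p\<in>A. emeasure (K p x) (E p)) \<in> borel_measurable N"
    using measurable_compose[OF measurable_prob_algebraD[OF K] measurable_emeasure_subprob_algebra] E
    by (intro borel_measurable_prod_ennreal) blast
  ultimately show "(\<lambda>x. emeasure (Pi\<^sub>M A (\<lambda>p. K p x)) X) \<in> borel_measurable N"
    by (simp cong: measurable_cong)
qed

text \<open>The derivatives are witnesses chosen separately for each \<open>y\<close>, so nothing is
  known about their dependence on \<open>y\<close>. The expansion determines them as limits of first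
  and second order difference quotients along \<open>c / (n + 1)\<close>, which are
  measurable.\<close>

lemma taylor_coefficients_measurable:
  fixes u :: "'d \<Rightarrow> real \<Rightarrow> real"
  assumes u[measurable]: "\<And>z. (\<lambda>y. u y z) \<in> borel_measurable M" and c: "0 < c" and B: "0 \<le> B"
    and \<beta>: "\<And>y. y \<in> space M \<Longrightarrow> \<bar>\<beta> y\<bar> \<le> B"
    and expand: "\<And>y z. y \<in> space M \<Longrightarrow> \<bar>z\<bar> \<le> c \<Longrightarrow> \<bar>u y z - \<alpha> y * z - \<beta> y * z\<^sup>2 / 2\<bar> \<le> B * \<bar>z\<bar> ^ 3"
  shows "\<alpha> \<in> borel_measurable M" "\<beta> \<in> borel_measurable M"
proof -
  define z where "z n = c / real (Suc n)" for n
  have z: "0 < z n" "z n \<le> c" for n using c by (auto simp: z_def field_simps)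
  have z0: "z \<longlonglongrightarrow> 0" unfolding z_def by (rule LIMSEQ_Suc[OF lim_const_over_n])
  have ex: "\<bar>u y (z n) - \<alpha> y * z n - \<beta> y * (z n)\<^sup>2 / 2\<bar> \<le> B * z n * (z n)\<^sup>2" if "y \<in> space M" for y n
    using expand[OF that, of "z n"] z[of n] by (simp add: power2_eq_square power3_eq_cube mult.assoc)
  show m: "\<alpha> \<in> borel_measurable M"
  proof (rule borel_measurable_LIMSEQ_real)
    fix y assume y: "y \<in> space M"
    have le: "\<bar>u y (z n) / z n - \<alpha> y\<bar> \<le> (B * c + B) * z n" for n
    proof -
      have "\<bar>\<beta> y * (z n)\<^sup>2\<bar> \<le> B * (z n)\<^sup>2" unfolding abs_mult using \<beta>[OF y] by (auto intro: mult_right_mono)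
      moreover have "B * z n * (z n)\<^sup>2 \<le> B * c * (z n)\<^sup>2" using z[of n] B by (intro mult_right_mono mult_left_mono) auto
      moreover have "0 \<le> B * (z n)\<^sup>2" using B by simp
      ultimately have "\<bar>u y (z n) - \<alpha> y * z n\<bar> \<le> B * c * (z n)\<^sup>2 + B * (z n)\<^sup>2"
        using ex[OF y, of n] by linarith
      also have "\<dots> = ((B * c + B) * z n) * z n" by (simp add: power2_eq_square algebra_simps)
      finally have "\<bar>u y (z n) - \<alpha> y * z n\<bar> / z n \<le> (B * c + B) * z n" using z[of n] by (simp add: divide_le_eq)
      moreover have "\<bar>u y (z n) - \<alpha> y * z n\<bar> / z n = \<bar>u y (z n) / z n - \<alpha> y\<bar>"
      proof -
        have "u y (z n) / z n - \<alpha> y = (u y (z n) - \<alpha> y * z n) / z n" using z[of n] by (simp add: diff_divide_distrib)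
        then show ?thesis using z[of n] by simp
      qed
      ultimately show ?thesis by simp
    qed
    have "(\<lambda>n. u y (z n) / z n - \<alpha> y) \<longlonglongrightarrow> 0"
      by (rule Lim_null_comparison[where g="\<lambda>n. (B * c + B) * z n"])
        (use le tendsto_mult_right_zero[OF z0] in auto)
    then show "(\<lambda>n. u y (z n) / z n) \<longlonglongrightarrow> \<alpha> y" by (rule LIM_zero_cancel)
  qed simp
  note [measurable] = m
  show "\<beta> \<in> borel_measurable M"
  proof (rule borel_measurable_LIMSEQ_real)
    fix y assume y: "y \<in> space M"
    have le: "\<bar>2 * (u y (z n) - \<alpha> y * z n) / (z n)\<^sup>2 - \<beta> y\<bar> \<le> 2 * B * z n" for n
    proof -
      have "\<bar>2 * (u y (z n) - \<alpha> y * z n) - \<beta> y * (z n)\<^sup>2\<bar> \<le> 2 * B * z n * (z n)\<^sup>2"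
      proof -
        have "2 * B * z n * (z n)\<^sup>2 = 2 * (B * z n * (z n)\<^sup>2)" by simp
        moreover have "\<bar>2 * p - r\<bar> \<le> 2 * q" if "\<bar>p - r / 2\<bar> \<le> q" for p q r :: real
          using that by linarith
        ultimately show ?thesis using ex[OF y, of n] by (simp only:)
      qed
      then have "\<bar>2 * (u y (z n) - \<alpha> y * z n) - \<beta> y * (z n)\<^sup>2\<bar> / (z n)\<^sup>2 \<le> 2 * B * z n"
        using z[of n] by (simp add: divide_le_eq)
      moreover have "\<bar>2 * (u y (z n) - \<alpha> y * z n) - \<beta> y * (z n)\<^sup>2\<bar> / (z n)\<^sup>2
          = \<bar>2 * (u y (z n) - \<alpha> y * z n) / (z n)\<^sup>2 - \<beta> y\<bar>"
      proof -
        have "2 * (u y (z n) - \<alpha> y * z n) / (z n)\<^sup>2 - \<beta> y = (2 * (u y (z n) - \<alpha> y * z n) - \<beta> y * (z n)\<^sup>2) / (z n)\<^sup>2"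
          using z[of n] by (simp add: diff_divide_distrib)
        then show ?thesis using z[of n] by simp
      qed
      ultimately show ?thesis by simp
    qed
    have "(\<lambda>n. 2 * (u y (z n) - \<alpha> y * z n) / (z n)\<^sup>2 - \<beta> y) \<longlonglongrightarrow> 0"
      by (rule Lim_null_comparison[where g="\<lambda>n. 2 * B * z n"])
        (use le tendsto_mult_right_zero[OF z0] in auto)
    then show "(\<lambda>n. 2 * (u y (z n) - \<alpha> y * z n) / (z n)\<^sup>2) \<longlonglongrightarrow> \<beta> y" by (rule LIM_zero_cancel)
  qed simp
qed

text \<open>Both channels are close to the same leading part with Fisher information
  \<open>a\<^sup>2\<close>, and \<open>7040000 = 7000000 + 40000\<close>. The increment
  \<open>g y z - g y 0\<close> is the log-likelihood ratio against the law at 0, which takes over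
  from \<open>\<mu>\<close> as reference measure.\<close>

lemma (in prob_space) pair_channel_comparison:
  fixes w :: "'a \<Rightarrow> real" and g :: "'d \<Rightarrow> real \<Rightarrow> real"
  assumes kernel: "P \<in> borel \<rightarrow>\<^sub>M prob_algebra \<mu>"
    and g[measurable]: "(\<lambda>(y, w). g y w) \<in> borel_measurable (\<mu> \<Otimes>\<^sub>M borel)"
    and S: "is_interval S" "{-c..c} \<subseteq> S"
    and bayes: "\<And>w. w \<in> S \<Longrightarrow> P w = density \<mu> (\<lambda>y. ennreal (exp (g y w)))"
    and reg: "\<And>y. y \<in> space \<mu> \<Longrightarrow> \<exists>g1 g2 g3 :: real \<Rightarrow> real.
        (\<forall>w\<in>S. (g y has_real_derivative g1 w) (at w within S) \<and>
           (g1 has_real_derivative g2 w) (at w within S) \<and>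
           (g2 has_real_derivative g3 w) (at w within S) \<and> \<bar>g3 w\<bar> \<le> B) \<and>
        \<bar>g1 0\<bar> \<le> B \<and> \<bar>g2 0\<bar> \<le> B"
    and a: "0 \<le> a" "a\<^sup>2 = (\<integral>y. (deriv (g y) 0)\<^sup>2 \<partial>P 0)"
    and w[measurable]: "w \<in> borel_measurable M" and wc: "\<And>x. x \<in> space M \<Longrightarrow> \<bar>w x\<bar> \<le> c" and w0: "\<bar>w0\<bar> \<le> c"
    and B: "1 \<le> B"
  shows "dominated_channel M (P w0) (\<lambda>y x. g y (w x) - g y 0)"
    and "\<bar>(\<integral>y. ln (\<integral>x. exp (g y (w x) - g y 0) \<partial>M) \<partial>P w0)
        - (\<integral>e. ln (\<integral>x. exp (a * e * w x + a\<^sup>2 * w0 * w x - a\<^sup>2 * (w x)\<^sup>2 / 2) \<partial>M) \<partial>std_normal_distribution)\<bar>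
      \<le> 7040000 * B ^ 12 * c ^ 3"
proof -
  have c0: "0 \<le> c" using w0 by linarith
  have cS: "z \<in> S" if "\<bar>z\<bar> \<le> c" for z using S(2) that by (auto simp: abs_le_iff)
  have S0: "0 \<in> S" using cS[of 0] c0 by simp
  have Pz: "prob_space (P z)" "sets (P z) = sets \<mu>" for z
    using measurable_space[OF kernel, of z] by (auto simp: space_prob_algebra)
  have sp: "space (P z) = space \<mu>" for z using Pz(2) by (rule sets_eq_imp_space_eq)
  interpret P0: prob_space "P 0" by (rule Pz)
  interpret Pw: prob_space "P w0" by (rule Pz)
  define u where "u y z = g y z - g y 0" for y z
  have "\<exists>ab. \<bar>fst ab\<bar> \<le> B \<and> \<bar>snd ab\<bar> \<le> B \<and>
      (\<forall>z. \<bar>z\<bar> \<le> c \<longrightarrow> \<bar>u y z - fst ab * z - snd ab * z\<^sup>2 / 2\<bar> \<le> B * \<bar>z\<bar> ^ 3) \<and>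
      (0 < c \<longrightarrow> deriv (g y) 0 = fst ab)" if y: "y \<in> space \<mu>" for y
  proof -
    obtain g1 g2 g3 where
      d: "\<And>w. w \<in> S \<Longrightarrow> (g y has_real_derivative g1 w) (at w within S)"
        "\<And>w. w \<in> S \<Longrightarrow> (g1 has_real_derivative g2 w) (at w within S)"
        "\<And>w. w \<in> S \<Longrightarrow> (g2 has_real_derivative g3 w) (at w within S)"
        "\<And>w. w \<in> S \<Longrightarrow> \<bar>g3 w\<bar> \<le> B" and b: "\<bar>g1 0\<bar> \<le> B" "\<bar>g2 0\<bar> \<le> B"
      using reg[OF y] by blast
    have t: "\<bar>u y z - g1 0 * z - g2 0 * z\<^sup>2 / 2\<bar> \<le> B * \<bar>z\<bar> ^ 3" if "\<bar>z\<bar> \<le> c" for z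
      unfolding u_def by (rule second_order_taylor_bound[OF S(1) S0 cS[OF that] d])
    \<comment> \<open>\<open>deriv\<close> is two-sided, whereas \<open>g1\<close> is a derivative
      within \<open>S\<close>; they agree at 0 once 0 is interior, which \<open>0 < c\<close>
      ensures.\<close>
    have "deriv (g y) 0 = g1 0" if "0 < c"
    proof -
      have "0 \<in> interior S" using that S(2) interior_mono[of "{-c..c}" S] by (auto simp: interior_atLeastAtMost_real)
      then have "at 0 within S = at 0" by (rule at_within_interior)
      then show ?thesis using d(1)[OF S0] by (auto intro: DERIV_imp_deriv)
    qed
    then show ?thesis using t b by (intro exI[of _ "(g1 0, g2 0)"]) auto
  qed
  then have "\<forall>y\<in>space \<mu>. \<exists>ab. \<bar>fst ab\<bar> \<le> B \<and> \<bar>snd ab\<bar> \<le> B \<and>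
      (\<forall>z. \<bar>z\<bar> \<le> c \<longrightarrow> \<bar>u y z - fst ab * z - snd ab * z\<^sup>2 / 2\<bar> \<le> B * \<bar>z\<bar> ^ 3) \<and>
      (0 < c \<longrightarrow> deriv (g y) 0 = fst ab)" by (rule ballI)
  from bchoice[OF this] obtain ab where ab:
    "\<And>y. y \<in> space \<mu> \<Longrightarrow> \<bar>fst (ab y)\<bar> \<le> B" "\<And>y. y \<in> space \<mu> \<Longrightarrow> \<bar>snd (ab y)\<bar> \<le> B"
    "\<And>y z. y \<in> space \<mu> \<Longrightarrow> \<bar>z\<bar> \<le> c \<Longrightarrow>
        \<bar>u y z - fst (ab y) * z - snd (ab y) * z\<^sup>2 / 2\<bar> \<le> B * \<bar>z\<bar> ^ 3"
    "\<And>y. y \<in> space \<mu> \<Longrightarrow> 0 < c \<Longrightarrow> deriv (g y) 0 = fst (ab y)"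
    by auto
  define \<alpha> \<beta> where "\<alpha> y = fst (ab y)" and "\<beta> y = snd (ab y)" for y
  note ab = ab[folded \<alpha>_def \<beta>_def]
  have um: "(\<lambda>(y, z). u y z) \<in> borel_measurable (\<mu> \<Otimes>\<^sub>M borel)" unfolding u_def by measurable
  note [measurable] = um
  have [measurable_cong]: "sets (P z) = sets \<mu>" for z by (rule Pz)
  define s where "s = B * c + B * c\<^sup>2 / 2 + B * c ^ 3"
  have us: "\<bar>u y (w x)\<bar> \<le> s" if "y \<in> space (P w0)" "x \<in> space M" for y x
  proof -
    have y: "y \<in> space \<mu>" using that by (simp add: sp)
    have "\<bar>\<alpha> y * w x\<bar> \<le> B * c" unfolding abs_mult using ab(1)[OF y] wc[OF that(2)] B by (intro mult_mono) auto
    moreover have "\<bar>\<beta> y * (w x)\<^sup>2\<bar> \<le> B * c\<^sup>2"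
      unfolding abs_mult[of "\<beta> y"] using ab(2)[OF y] wc[OF that(2)] B c0 by (intro mult_mono) (auto simp: abs_le_square_iff[symmetric])
    moreover have "B * \<bar>w x\<bar> ^ 3 \<le> B * c ^ 3"
      using wc[OF that(2)] B by (intro mult_left_mono power_mono) auto
    ultimately show ?thesis using ab(3)[OF y wc[OF that(2)]] unfolding s_def by linarith
  qed
  show "dominated_channel M (P w0) (\<lambda>y x. g y (w x) - g y 0)"
    unfolding u_def[symmetric]
    by (rule dominated_channelI[OF Pw.prob_space_axioms _ _ us]) measurable
  show "\<bar>(\<integral>y. ln (\<integral>x. exp (g y (w x) - g y 0) \<partial>M) \<partial>P w0)
        - (\<integral>e. ln (\<integral>x. exp (a * e * w x + a\<^sup>2 * w0 * w x - a\<^sup>2 * (w x)\<^sup>2 / 2) \<partial>M) \<partial>std_normal_distribution)\<bar>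
      \<le> 7040000 * B ^ 12 * c ^ 3"
  proof (cases "c = 0")
    \<comment> \<open>\<open>S\<close> may be a single point here, and then \<open>deriv\<close> and
      \<open>a\<close> are unrelated to the regularity bounds. But all overlaps vanish, and both
      logarithms are 0.\<close>
    case True
    then have wz: "w x = 0" if "x \<in> space M" for x using wc[OF that] by simp
    have "(\<integral>x. exp (g y (w x) - g y 0) \<partial>M) = (\<integral>x. 1 \<partial>M)"
      "(\<integral>x. exp (a * e * w x + a\<^sup>2 * w0 * w x - a\<^sup>2 * (w x)\<^sup>2 / 2) \<partial>M) = (\<integral>x. 1 \<partial>M)" for y e
      by (rule Bochner_Integration.integral_cong[OF refl], simp add: wz)+
    then show ?thesis by (simp add: prob_space True)
  next
    case False
    then have c: "0 < c" using c0 by simp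
    have meas: "(\<lambda>y. u y z) \<in> borel_measurable (P 0)" for z by measurable
    have um0: "(\<lambda>(y, z). u y z) \<in> borel_measurable (P 0 \<Otimes>\<^sub>M borel)" by measurable
    have B0: "0 \<le> B" using B by simp
    note coeff = taylor_coefficients_measurable[where \<alpha>=\<alpha> and \<beta>=\<beta>, OF meas c B0, unfolded sp, OF ab(2,3), simplified]
    have dens: "P z = density (P 0) (\<lambda>y. ennreal (exp (u y z)))" if z: "\<bar>z\<bar> \<le> c" for z
    proof -
      have [measurable]: "(\<lambda>y. g y z) \<in> borel_measurable \<mu>" "(\<lambda>y. g y 0) \<in> borel_measurable \<mu>"
        "(\<lambda>y. u y z) \<in> borel_measurable \<mu>" by measurable
      show ?thesis unfolding bayes[OF cS[OF z]] bayes[OF S0]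
        by (subst density_density_eq) (auto simp: u_def exp_diff ennreal_mult[symmetric] intro!: density_cong)
    qed
    have norm: "(\<integral>y. exp (u y z) \<partial>P 0) = 1" if z: "\<bar>z\<bar> \<le> c" for z
    proof -
      have "emeasure (P z) (space (P 0)) = (\<integral>\<^sup>+y. ennreal (exp (u y z)) \<partial>P 0)"
        unfolding dens[OF z] by (subst emeasure_density) (auto intro!: nn_integral_cong simp: indicator_def)
      then have "(\<integral>\<^sup>+y. ennreal (exp (u y z)) \<partial>P 0) = 1"
        using prob_space.emeasure_space_1[OF Pz(1)[of z]] by (simp add: sp)
      then show ?thesis by (subst integral_eq_nn_integral) auto
    qed
    have I: "a\<^sup>2 = (\<integral>y. (\<alpha> y)\<^sup>2 \<partial>P 0)"
      unfolding a(2) by (rule Bochner_Integration.integral_cong) (auto simp: sp ab(4) c)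
    have "\<bar>(\<alpha> y)\<^sup>2\<bar> \<le> B\<^sup>2" if "y \<in> space (P 0)" for y
      using ab(1)[of y] that B by (simp add: sp abs_le_square_iff[symmetric])
    then have "a\<^sup>2 \<le> B\<^sup>2" using P0.abs_expectation_le(2)[of "\<lambda>y. (\<alpha> y)\<^sup>2" "B\<^sup>2"] coeff I by auto
    then have aB: "a \<le> B" using B0 by (rule power2_le_imp_le)
    have "\<bar>(\<integral>y. ln (\<integral>x. exp (u y (w x)) \<partial>M) \<partial>P w0) - a\<^sup>2 * (w0 * expectation w - (expectation w)\<^sup>2 / 2)\<bar>
      \<le> 7000000 * B ^ 12 * c ^ 3"
      by (rule llh_channel_step[where u=u and \<alpha>=\<alpha> and \<beta>=\<beta> and P="P 0", OF w wc w0 P0.prob_space_axioms um0 coeff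
            _ _ _ norm dens[OF w0] I B c]; simp add: sp ab)
    moreover have "\<bar>(\<integral>e. ln (\<integral>x. exp (a * e * w x + a\<^sup>2 * w0 * w x - a\<^sup>2 * (w x)\<^sup>2 / 2) \<partial>M) \<partial>std_normal_distribution)
      - a\<^sup>2 * (w0 * expectation w - (expectation w)\<^sup>2 / 2)\<bar> \<le> 40000 * B ^ 12 * c ^ 3"
      by (rule gauss_channel_step[OF w wc w0 a(1) aB B])
    ultimately show ?thesis unfolding u_def by linarith
  qed
qed

lemma finite_pairs: "finite (pairs N)" and card_pairs_le: "card (pairs N) \<le> N\<^sup>2"
proof -
  have s: "pairs N \<subseteq> {1..N} \<times> {1..N}" by (auto simp: pairs_def)
  then show "finite (pairs N)" by (rule finite_subset) simp
  have "card (pairs N) \<le> card ({1..N} \<times> {1..N})" using s by (intro card_mono) auto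
  then show "card (pairs N) \<le> N\<^sup>2" by (simp add: card_cartesian_product power2_eq_square)
qed

text \<open>Integrability of \<open>f\<close> follows from that of \<open>g\<close> and the bounded
  difference. This spares a direct proof that the conditional free energy of the spin model is
  integrable in \<open>x0\<close>.\<close>

lemma integral_difference_bound:
  fixes f g :: "'a \<Rightarrow> real"
  assumes M: "prob_space M" and f: "f \<in> borel_measurable M" and g: "integrable M g"
    and fg: "\<And>x. x \<in> space M \<Longrightarrow> \<bar>f x - g x\<bar> \<le> e"
  shows "\<bar>(\<integral>x. f x \<partial>M) - (\<integral>x. g x \<partial>M)\<bar> \<le> e"
proof -
  interpret prob_space M by (rule M)
  have d: "(\<lambda>x. f x - g x) \<in> borel_measurable M" using f g by simp
  have i: "integrable M (\<lambda>x. f x - g x)" by (rule abs_expectation_le(1)[OF d fg])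
  then have "integrable M f" using Bochner_Integration.integrable_add[OF i g] by simp
  then have "(\<integral>x. f x \<partial>M) - (\<integral>x. g x \<partial>M) = (\<integral>x. f x - g x \<partial>M)" using g by simp
  then show ?thesis using abs_expectation_le(2)[OF d fg] by simp
qed

section \<open>Comparison of the two free energies\<close>

lemma dot_measurable:
  assumes sets: "sets P0 = sets (vec_space \<kappa>)" and f: "f \<in> N \<rightarrow>\<^sub>M P0" and h: "h \<in> N \<rightarrow>\<^sub>M P0"
  shows "(\<lambda>z. dot \<kappa> (f z) (h z)) \<in> borel_measurable N"
proof -
  have comp: "(\<lambda>z. k z a) \<in> borel_measurable N" if "a < \<kappa>" "k \<in> N \<rightarrow>\<^sub>M P0" for a k
  proof -
    have "k \<in> N \<rightarrow>\<^sub>M vec_space \<kappa>" using that(2) measurable_cong_sets[OF refl sets] by blast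
    from measurable_compose[OF this measurable_component_singleton[of a "{..<\<kappa>}" "\<lambda>_. borel"]] that(1)
    show ?thesis by simp
  qed
  then show ?thesis unfolding dot_def by (intro borel_measurable_sum borel_measurable_times comp[OF _ f] comp[OF _ h]) auto
qed

lemma dot_bound:
  assumes "\<forall>a<\<kappa>. x a \<in> {- C..C}" "\<forall>a<\<kappa>. y a \<in> {- C..C}"
  shows "\<bar>dot \<kappa> x y\<bar> \<le> C\<^sup>2 * real \<kappa>"
proof -
  have "\<bar>dot \<kappa> x y\<bar> \<le> (\<Sum>a<\<kappa>. \<bar>x a * y a\<bar>)" unfolding dot_def by (rule sum_abs)
  also have "\<dots> \<le> (\<Sum>a<\<kappa>. C * C)"
  proof (rule sum_mono)
    fix a assume "a \<in> {..<\<kappa>}"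
    then have "\<bar>x a\<bar> \<le> C" "\<bar>y a\<bar> \<le> C" using assms by (auto simp: abs_le_iff)
    then show "\<bar>x a * y a\<bar> \<le> C * C" unfolding abs_mult by (intro mult_mono) auto
  qed
  also have "\<dots> = C\<^sup>2 * real \<kappa>" by (simp add: power2_eq_square)
  finally show ?thesis .
qed

text \<open>
  The overlaps are clipped to \<open>[-c, c]\<close>, which changes nothing almost surely and makes all bounds hold
  everywhere.
\<close>

definition overlap :: "nat \<Rightarrow> nat \<Rightarrow> nat \<times> nat \<Rightarrow> config \<Rightarrow> real" where
  "overlap \<kappa> N p x = dot \<kappa> (x (fst p)) (x (snd p)) / sqrt (real N)"

definition clipped_overlap :: "nat \<Rightarrow> nat \<Rightarrow> real \<Rightarrow> nat \<times> nat \<Rightarrow> config \<Rightarrow> real" where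
  "clipped_overlap \<kappa> N c p x = max (- c) (min c (overlap \<kappa> N p x))"

lemma clipped_overlap_bound: "0 \<le> c \<Longrightarrow> \<bar>clipped_overlap \<kappa> N c p x\<bar> \<le> c"
  by (auto simp: clipped_overlap_def)

lemma overlap_measurable:
  assumes "sets P0 = sets (vec_space \<kappa>)" "p \<in> pairs N"
  shows "overlap \<kappa> N p \<in> borel_measurable (iid N P0)" "clipped_overlap \<kappa> N c p \<in> borel_measurable (iid N P0)"
proof -
  have "fst p \<in> {1..N}" "snd p \<in> {1..N}" using assms(2) by (auto simp: pairs_def)
  then show 1: "overlap \<kappa> N p \<in> borel_measurable (iid N P0)"
    unfolding overlap_def
    by (intro borel_measurable_divide dot_measurable[OF assms(1)] measurable_component_singleton) auto
  show "clipped_overlap \<kappa> N c p \<in> borel_measurable (iid N P0)"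
    unfolding clipped_overlap_def using 1 by simp
qed

lemma AE_clipped_overlap:
  assumes P0: "prob_space P0" and supp: "supported_in_cube \<kappa> C P0"
    and c: "c = C\<^sup>2 * real \<kappa> / sqrt (real N)"
  shows "AE x in iid N P0. \<forall>p\<in>pairs N. clipped_overlap \<kappa> N c p x = overlap \<kappa> N p x"
proof -
  have "AE x in iid N P0. \<forall>i\<in>{1..N}. \<forall>a<\<kappa>. x i a \<in> {- C..C}"
  proof (rule AE_finite_allI)
    show "AE x in iid N P0. \<forall>a<\<kappa>. x i a \<in> {- C..C}" if "i \<in> {1..N}" for i
      by (rule AE_PiM_component[where M="\<lambda>_. P0" and I="{1..N}" and P="\<lambda>v. \<forall>a<\<kappa>. v a \<in> {- C..C}", OF P0 that])
        (rule supp[unfolded supported_in_cube_def])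
  qed simp
  then show ?thesis
  proof eventually_elim
    case (elim x)
    show ?case
    proof
      fix p assume "p \<in> pairs N"
      then have "fst p \<in> {1..N}" "snd p \<in> {1..N}" by (auto simp: pairs_def)
      then have "\<bar>overlap \<kappa> N p x\<bar> \<le> c"
        unfolding overlap_def c abs_divide using elim
        by (simp add: divide_right_mono dot_bound)
      then show "clipped_overlap \<kappa> N c p x = overlap \<kappa> N p x"
        by (auto simp: clipped_overlap_def)
    qed
  qed
qed

text \<open>The terms \<open>k p\<close> do not depend on \<open>x\<close> and move into the
  exponent. This leaves bounded increments, although \<open>g\<close> at overlap 0 need not be
  bounded in the data; the bound also gives the positivity needed to split the logarithm.\<close>

lemma log_partition_normalised:
  assumes "prob_space X"
    and "\<And>p. p \<in> A \<Longrightarrow> h p \<in> borel_measurable X" "\<And>p x. p \<in> A \<Longrightarrow> x \<in> space X \<Longrightarrow> \<bar>h p x - k p\<bar> \<le> s p"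
    and A: "finite A"
  shows "ln (\<integral>x. (\<Prod>p\<in>A. exp (h p x :: real)) \<partial>X) - (\<Sum>p\<in>A. k p) = ln (\<integral>x. exp (\<Sum>p\<in>A. h p x - k p) \<partial>X)"
proof -
  interpret prob_space X by fact
  have m: "(\<lambda>x. \<Sum>p\<in>A. h p x - k p) \<in> borel_measurable X" using assms(2) by simp
  have "exp (- (\<Sum>p\<in>A. s p)) \<le> (\<integral>x. exp (\<Sum>p\<in>A. h p x - k p) \<partial>X)"
    by (rule log_exp_moment_bound(2)[OF m]) (auto intro!: order_trans[OF sum_abs] sum_mono assms(3))
  then have pos: "0 < (\<integral>x. exp (\<Sum>p\<in>A. h p x - k p) \<partial>X)" using exp_gt_zero[of "- (\<Sum>p\<in>A. s p)"] by linarith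
  have "(\<Prod>p\<in>A. exp (h p x)) = exp (\<Sum>p\<in>A. k p) * exp (\<Sum>p\<in>A. h p x - k p)" for x
    using A by (simp add: exp_sum[symmetric] exp_add[symmetric] sum_subtractf)
  then show ?thesis using pos by (simp add: ln_mult_pos)
qed

text \<open>No sign condition on \<open>\<Delta>\<close> is needed: \<open>sqrt\<close> is
  multiplicative on all reals, and with \<open>1 / 0 = 0\<close> the case of vanishing Fisher
  information is included.\<close>

lemma gauss_hamiltonian_overlap:
  assumes "0 < N"
  shows "gauss_hamiltonian \<kappa> \<Delta> N W x0 x = (\<Sum>p\<in>pairs N.
      sqrt (1 / \<Delta> N (fst p) (snd p)) * W p * overlap \<kappa> N p x
      + 1 / \<Delta> N (fst p) (snd p) * overlap \<kappa> N p x0 * overlap \<kappa> N p x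
      - 1 / \<Delta> N (fst p) (snd p) * (overlap \<kappa> N p x)\<^sup>2 / 2)"
  unfolding gauss_hamiltonian_def case_prod_beta
proof (rule sum.cong[OF refl])
  fix p assume "p \<in> pairs N"
  define d s where "d = \<Delta> N (fst p) (snd p)" and "s = sqrt (real N)"
  have s: "s * s = real N" "0 < s" using assms by (auto simp: s_def)
  have "W (fst p, snd p) / sqrt (d * real N) * dot \<kappa> (x (fst p)) (x (snd p))
      = sqrt (1 / d) * W p * overlap \<kappa> N p x"
    by (simp add: real_sqrt_mult real_sqrt_divide overlap_def)
  moreover have "1 / (d * real N) * dot \<kappa> (x0 (fst p)) (x0 (snd p)) * dot \<kappa> (x (fst p)) (x (snd p))
      = 1 / d * overlap \<kappa> N p x0 * overlap \<kappa> N p x"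
    unfolding overlap_def s_def[symmetric] s(1)[symmetric] by simp
  moreover have "1 / (2 * d * real N) * (dot \<kappa> (x (fst p)) (x (snd p)))\<^sup>2 = 1 / d * (overlap \<kappa> N p x)\<^sup>2 / 2"
    unfolding overlap_def s_def[symmetric] s(1)[symmetric] by (simp add: power2_eq_square)
  ultimately show "W (fst p, snd p) / sqrt (\<Delta> N (fst p) (snd p) * real N) * dot \<kappa> (x (fst p)) (x (snd p))
        + 1 / (\<Delta> N (fst p) (snd p) * real N) * dot \<kappa> (x0 (fst p)) (x0 (snd p)) * dot \<kappa> (x (fst p)) (x (snd p))
        - 1 / (2 * \<Delta> N (fst p) (snd p) * real N) * (dot \<kappa> (x (fst p)) (x (snd p)))\<^sup>2
      = sqrt (1 / \<Delta> N (fst p) (snd p)) * W p * overlap \<kappa> N p x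
        + 1 / \<Delta> N (fst p) (snd p) * overlap \<kappa> N p x0 * overlap \<kappa> N p x
        - 1 / \<Delta> N (fst p) (snd p) * (overlap \<kappa> N p x)\<^sup>2 / 2"
    unfolding d_def by simp
qed

text \<open>For fixed \<open>x0\<close> the exchange bounds the distance of the conditional averages
  \<open>F w\<close> and \<open>G\<close>. The rest brings both free energies to this form: one is
  an iterated integral against a kernel, the other a joint integral over noise and
  \<open>x0\<close>, and in both the clipping must be justified for \<open>x0\<close> and for the
  integration variable.\<close>

lemma fixed_size_bound:
  fixes \<mu> :: "'d measure"
  assumes model: "spin_model \<kappa> P0 P0 \<mu> P g" and dom: "admissible_domain \<kappa> C S"
    and bayes: "bayes_optimal P0 P0 \<mu> S P g" and supp: "supported_in_cube \<kappa> C P0"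
    and reg: "regular_llh B \<mu> S g" and var: "variance_profile P g \<Delta>"
    and B: "1 \<le> B" and N: "1 \<le> N" and c: "c = C\<^sup>2 * real \<kappa> / sqrt (real N)"
  shows "\<bar>free_energy \<kappa> P0 P0 P g N - gauss_free_energy \<kappa> P0 \<Delta> N\<bar>
    \<le> 1 / real N * (real (card (pairs N)) * (7040000 * B ^ 12 * c ^ 3))"
proof -
  define X where "X = iid N P0"
  define A where "A = pairs N"
  define w ov where "w = clipped_overlap \<kappa> N c" and "ov = overlap \<kappa> N"
  define h where "h p = g N (fst p) (snd p)" for p
  define R where "R p = P N (fst p) (snd p)" for p
  define a where "a p = sqrt (1 / \<Delta> N (fst p) (snd p))" for p
  define \<Gamma> where "\<Gamma> = Pi\<^sub>M A (\<lambda>_. std_normal_distribution)"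
  define \<epsilon> where "\<epsilon> = 7040000 * B ^ 12 * c ^ 3"
  have c0: "0 \<le> c" by (simp add: c)
  have P0: "prob_space P0" and setsP0: "sets P0 = sets (vec_space \<kappa>)"
    using model by (auto simp: spin_model_def)
  have finA: "finite A" by (simp add: A_def finite_pairs)
  interpret X: prob_space X unfolding X_def by (rule prob_space_PiM) (rule P0)
  have normal: "prob_space std_normal_distribution" by (rule prob_space_normal_density) simp
  interpret \<Gamma>: prob_space \<Gamma> unfolding \<Gamma>_def by (rule prob_space_PiM) (rule normal)
  interpret \<Gamma>X: pair_prob_space \<Gamma> X ..
  have ker: "R p \<in> borel \<rightarrow>\<^sub>M prob_algebra \<mu>"
    and hm: "(\<lambda>(y, w). h p y w) \<in> borel_measurable (\<mu> \<Otimes>\<^sub>M borel)" if "p \<in> A" for p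
    using model N that by (cases p; force simp: spin_model_def A_def R_def h_def)+
  have S: "is_interval (S N)" "{-c..c} \<subseteq> S N" using dom N unfolding admissible_domain_def c by auto
  have bay: "R p w = density \<mu> (\<lambda>y. ennreal (exp (h p y w)))" if "p \<in> A" "w \<in> S N" for p w
    using bayes N that by (cases p; force simp: bayes_optimal_def A_def R_def h_def)
  have reg': "\<exists>g1 g2 g3 :: real \<Rightarrow> real.
        (\<forall>w\<in>S N. (h p y has_real_derivative g1 w) (at w within S N) \<and>
           (g1 has_real_derivative g2 w) (at w within S N) \<and>
           (g2 has_real_derivative g3 w) (at w within S N) \<and> \<bar>g3 w\<bar> \<le> B) \<and>
        \<bar>g1 0\<bar> \<le> B \<and> \<bar>g2 0\<bar> \<le> B" if "p \<in> A" "y \<in> space \<mu>" for p y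
    using reg N that unfolding regular_llh_def A_def h_def by (cases p) fastforce
  have var': "1 / \<Delta> N (fst p) (snd p) = (\<integral>y. (deriv (h p y) 0)\<^sup>2 \<partial>R p 0)" if "p \<in> A" for p
    using var N that unfolding variance_profile_def A_def h_def R_def by (cases p) fastforce
  have a0: "0 \<le> a p" and aI: "(a p)\<^sup>2 = 1 / \<Delta> N (fst p) (snd p)" if "p \<in> A" for p
  proof -
    have "0 \<le> 1 / \<Delta> N (fst p) (snd p)" unfolding var'[OF that] by (rule Bochner_Integration.integral_nonneg) simp
    then show "0 \<le> a p" "(a p)\<^sup>2 = 1 / \<Delta> N (fst p) (snd p)" unfolding a_def by (simp_all only: real_sqrt_ge_zero real_sqrt_pow2)
  qed
  have om: "ov p \<in> borel_measurable X" and wm: "w p \<in> borel_measurable X" if "p \<in> A" for p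
    using that unfolding X_def A_def w_def ov_def by (intro overlap_measurable[OF setsP0]; assumption)+
  have wc: "\<bar>w p x\<bar> \<le> c" for p x unfolding w_def ov_def by (rule clipped_overlap_bound[OF c0])
  have AEw: "AE x in X. \<forall>p\<in>A. w p x = ov p x"
    unfolding X_def A_def w_def ov_def by (rule AE_clipped_overlap[OF P0 supp c])
  define u where "u p y x = h p y (w p x) - h p y 0" for p y x
  define v where "v x0 p e x = a p * e * w p x + (a p)\<^sup>2 * w p x0 * w p x - (a p)\<^sup>2 * (w p x)\<^sup>2 / 2" for x0 p e x
  define \<phi> where "\<phi> D = ln (\<integral>x. exp (\<Sum>p\<in>A. u p (D p) x) \<partial>X)" for D
  \<comment> \<open>The overlap is a parameter because the data law depends on the overlap of
    \<open>x0\<close>: \<open>F ov\<close> is what the model defines, \<open>F w\<close> is what the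
    exchange bounds.\<close>
  define F where "F f x0 = (\<integral>D. \<phi> D \<partial>Pi\<^sub>M A (\<lambda>p. R p (f p x0)))" for f :: "nat \<times> nat \<Rightarrow> config \<Rightarrow> real" and x0
  define G where "G x0 = (\<integral>W. ln (\<integral>x. exp (\<Sum>p\<in>A. v x0 p (W p) x) \<partial>X) \<partial>\<Gamma>)" for x0
  have udom: "dominated_channel X (R p (w p x0)) (u p)"
    and step: "prob_space M' \<Longrightarrow> sets M' = sets X \<Longrightarrow>
      \<bar>(\<integral>d. ln (\<integral>x. exp (u p d x) \<partial>M') \<partial>R p (w p x0)) - (\<integral>e. ln (\<integral>x. exp (v x0 p e x) \<partial>M') \<partial>std_normal_distribution)\<bar> \<le> \<epsilon>"
    if p: "p \<in> A" for p x0 M'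
  proof -
    have a2: "(a p)\<^sup>2 = (\<integral>y. (deriv (h p y) 0)\<^sup>2 \<partial>R p 0)" using aI[OF p] var'[OF p] by simp
    note cmp = prob_space.pair_channel_comparison[where w="w p" and ?w0.0="w p x0" and c=c, OF _ ker[OF p] hm[OF p] S bay[OF p] reg'[OF p] a0[OF p] a2 _ wc wc B]
    show "dominated_channel X (R p (w p x0)) (u p)"
      unfolding u_def by (rule cmp(1)[OF X.prob_space_axioms _ _ wm[OF p]])
    show "\<bar>(\<integral>d. ln (\<integral>x. exp (u p d x) \<partial>M') \<partial>R p (w p x0)) - (\<integral>e. ln (\<integral>x. exp (v x0 p e x) \<partial>M') \<partial>std_normal_distribution)\<bar> \<le> \<epsilon>"
      if M': "prob_space M'" "sets M' = sets X"
    proof -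
      have wM: "w p \<in> borel_measurable M'" using wm[OF p] measurable_cong_sets[OF M'(2) refl] by blast
      show ?thesis unfolding u_def v_def \<epsilon>_def by (rule cmp(2)[OF M'(1) _ _ wM])
    qed
  qed
  have vbound: "\<bar>v x0 p e x\<bar> \<le> a p * c * ((1 + e\<^sup>2) / 2) + 3 / 2 * (a p)\<^sup>2 * c\<^sup>2" if "p \<in> A" "x \<in> space X" for x0 p e x
    unfolding v_def by (rule gauss_channel_dominated(2)[OF wm[OF that(1)] wc wc a0[OF that(1)] order_refl c0 that(2)])
  have vdom: "dominated_channel X std_normal_distribution (v x0 p)" if "p \<in> A" for x0 p
    unfolding v_def by (rule gauss_channel_dominated(1)[OF wm[OF that(1)] wc wc a0[OF that(1)] order_refl c0])
  have close: "\<bar>F w x0 - G x0\<bar> \<le> real (card A) * \<epsilon>" for x0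
  proof -
    \<comment> \<open>The exchange lemma wants a probability measure at every index; outside
      \<open>A\<close> any point mass will do.\<close>
    define Q where "Q p = (if p \<in> A then R p (w p x0) else return (count_space UNIV) undefined)" for p
    have Q: "prob_space (Q p)" for p
      using dominated_channelD(1)[OF udom] by (auto simp: Q_def prob_space_return)
    have "Pi\<^sub>M A (\<lambda>p. R p (w p x0)) = Pi\<^sub>M A Q" by (intro PiM_cong) (auto simp: Q_def)
    moreover have "\<bar>(\<integral>D. ln (\<integral>x. exp (0 + (\<Sum>p\<in>A. u p (D p) x)) \<partial>X) \<partial>Pi\<^sub>M A Q)
        - (\<integral>W. ln (\<integral>x. exp (0 + (\<Sum>p\<in>A. v x0 p (W p) x)) \<partial>X) \<partial>Pi\<^sub>M A (\<lambda>_. std_normal_distribution))\<bar>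
        \<le> real (card A) * \<epsilon>"
      by (rule X.channel_exchange[where b=0 and H="\<lambda>_. 0", OF finA Q normal]; simp add: Q_def udom vdom step)
    ultimately show ?thesis by (simp add: F_def G_def \<phi>_def \<Gamma>_def)
  qed
  have usum: "(\<lambda>(D, x). \<Sum>p\<in>A. u p (D p) x) \<in> borel_measurable (Pi\<^sub>M A (\<lambda>_. \<mu>) \<Otimes>\<^sub>M X)"
    unfolding case_prod_beta' u_def
  proof (intro borel_measurable_sum borel_measurable_diff)
    fix p assume p: "p \<in> A"
    have D: "(\<lambda>z. fst z p) \<in> Pi\<^sub>M A (\<lambda>_. \<mu>) \<Otimes>\<^sub>M X \<rightarrow>\<^sub>M \<mu>"
      by (rule measurable_compose[OF measurable_fst measurable_component_singleton[OF p]])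
    show "(\<lambda>z. h p (fst z p) (w p (snd z))) \<in> borel_measurable (Pi\<^sub>M A (\<lambda>_. \<mu>) \<Otimes>\<^sub>M X)"
      by (rule measurable_Pair_compose_split[OF hm[OF p] D measurable_compose[OF measurable_snd wm[OF p]]])
    show "(\<lambda>z. h p (fst z p) 0) \<in> borel_measurable (Pi\<^sub>M A (\<lambda>_. \<mu>) \<Otimes>\<^sub>M X)"
      by (rule measurable_Pair_compose_split[OF hm[OF p] D]) simp
  qed
  \<comment> \<open>\<open>\<phi>\<close> lives on a space built from \<open>\<mu>\<close> alone, so
    it can be integrated against the law selected by any \<open>x0\<close>.\<close>
  have \<phi>m: "\<phi> \<in> borel_measurable (Pi\<^sub>M A (\<lambda>_. \<mu>))"
  proof -
    note [measurable] = usum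
    show ?thesis unfolding \<phi>_def by measurable
  qed
  have kernel: "(\<lambda>x0. Pi\<^sub>M A (\<lambda>p. R p (f p x0))) \<in> X \<rightarrow>\<^sub>M prob_algebra (Pi\<^sub>M A (\<lambda>_. \<mu>))"
    if "\<And>p. p \<in> A \<Longrightarrow> f p \<in> borel_measurable X" for f
    by (rule measurable_PiM_kernel[OF finA]) (rule measurable_compose[OF that ker])
  \<comment> \<open>Needed for both overlaps, as their almost sure replacement asks for
    measurability of both sides.\<close>
  have Fm: "F f \<in> borel_measurable X" if "\<And>p. p \<in> A \<Longrightarrow> f p \<in> borel_measurable X" for f
    unfolding F_def
    by (rule measurable_compose[OF measurable_prob_algebraD[OF kernel[OF that]] integral_measurable_subprob_algebra[OF \<phi>m]])
  have free: "free_energy \<kappa> P0 P0 P g N = 1 / real N * (\<integral>x0. F w x0 \<partial>X)"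
  proof -
    have part: "ln (partition_fun \<kappa> P0 g N D) - (\<Sum>(i, j)\<in>pairs N. g N i j (D (i, j)) 0) = \<phi> D"
      if D: "D \<in> space (Pi\<^sub>M A (\<lambda>_. \<mu>))" for D
    proof -
      have Dp: "D p \<in> space \<mu>" if "p \<in> A" for p using D that by (auto simp: space_PiM PiE_def)
      have hmp: "(\<lambda>x. h p (D p) (f x)) \<in> borel_measurable X" if "p \<in> A" "f \<in> borel_measurable X" for p f
        by (rule measurable_Pair_compose_split[OF hm[OF that(1)] measurable_const[OF Dp[OF that(1)]] that(2)])
      have "\<exists>b. \<forall>x\<in>space X. \<bar>u p (D p) x\<bar> \<le> b" if p: "p \<in> A" for p
      proof (rule dominated_channelD(4)[OF udom[OF p]])
        \<comment> \<open>The bound concerns the datum only, so any true configuration serves;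
          \<open>undefined\<close> merely picks one.\<close>
        show "D p \<in> space (R p (w p undefined))"
          using Dp[OF p] measurable_space[OF ker[OF p], of "w p undefined"]
          by (auto simp: space_prob_algebra dest: sets_eq_imp_space_eq)
      qed
      then have "\<forall>p\<in>A. \<exists>b. \<forall>x\<in>space X. \<bar>u p (D p) x\<bar> \<le> b" by (rule ballI)
      from bchoice[OF this] obtain b where b: "\<And>p x. p \<in> A \<Longrightarrow> x \<in> space X \<Longrightarrow> \<bar>u p (D p) x\<bar> \<le> b p" by auto
      have "partition_fun \<kappa> P0 g N D = (\<integral>x. (\<Prod>p\<in>A. exp (h p (D p) (ov p x))) \<partial>X)"
        by (simp add: partition_fun_def X_def A_def h_def w_def ov_def overlap_def case_prod_beta)
      also have "\<dots> = (\<integral>x. (\<Prod>p\<in>A. exp (h p (D p) (w p x))) \<partial>X)"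
      proof (rule integral_cong_AE)
        show "AE x in X. (\<Prod>p\<in>A. exp (h p (D p) (ov p x))) = (\<Prod>p\<in>A. exp (h p (D p) (w p x)))"
          using AEw by eventually_elim simp
      qed (intro borel_measurable_prod measurable_compose[OF _ borel_measurable_exp] hmp om wm; assumption)+
      finally have "ln (partition_fun \<kappa> P0 g N D) = ln (\<integral>x. (\<Prod>p\<in>A. exp (h p (D p) (w p x))) \<partial>X)" by simp
      moreover have "(\<Sum>(i, j)\<in>pairs N. g N i j (D (i, j)) 0) = (\<Sum>p\<in>A. h p (D p) 0)"
        by (simp add: A_def h_def case_prod_beta)
      moreover have "ln (\<integral>x. (\<Prod>p\<in>A. exp (h p (D p) (w p x))) \<partial>X) - (\<Sum>p\<in>A. h p (D p) 0) = \<phi> D"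
        unfolding \<phi>_def u_def
        by (rule log_partition_normalised[OF X.prob_space_axioms hmp[OF _ wm] _ finA]) (use b in \<open>auto simp: u_def\<close>)
      ultimately show ?thesis by simp
    qed
    have law: "data_law \<kappa> P N x0 = Pi\<^sub>M A (\<lambda>p. R p (ov p x0))" for x0
      by (simp add: data_law_def A_def R_def w_def ov_def overlap_def case_prod_beta')
    have "free_energy \<kappa> P0 P0 P g N = 1 / real N * (\<integral>x0. F ov x0 \<partial>X)"
      unfolding free_energy_def X_def[symmetric]
    proof (intro arg_cong[where f="\<lambda>t. 1 / real N * t"] Bochner_Integration.integral_cong refl)
      fix x0 assume x0: "x0 \<in> space X"
      have "sets (data_law \<kappa> P N x0) = sets (Pi\<^sub>M A (\<lambda>_. \<mu>))"
        using measurable_space[OF kernel[OF om] x0] unfolding law by (simp add: space_prob_algebra)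
      then have "space (data_law \<kappa> P N x0) = space (Pi\<^sub>M A (\<lambda>_. \<mu>))" by (rule sets_eq_imp_space_eq)
      then show "(\<integral>D. ln (partition_fun \<kappa> P0 g N D) - (\<Sum>(i, j)\<in>pairs N. g N i j (D (i, j)) 0) \<partial>data_law \<kappa> P N x0) = F ov x0"
        unfolding F_def law[symmetric] by (intro Bochner_Integration.integral_cong refl part) simp
    qed
    also have "(\<integral>x0. F ov x0 \<partial>X) = (\<integral>x0. F w x0 \<partial>X)"
    proof (rule integral_cong_AE)
      show "AE x0 in X. F ov x0 = F w x0"
        using AEw
      proof eventually_elim
        case (elim x0)
        then have "Pi\<^sub>M A (\<lambda>p. R p (ov p x0)) = Pi\<^sub>M A (\<lambda>p. R p (w p x0))" by (intro PiM_cong) auto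
        then show ?case by (simp add: F_def)
      qed
    qed (intro Fm om wm; assumption)+
    finally show ?thesis .
  qed
  have gauss: "gauss_free_energy \<kappa> P0 \<Delta> N = 1 / real N * (\<integral>x0. G x0 \<partial>X)" and Gi: "integrable X G"
  proof -
    define H where "H f z x = (\<Sum>p\<in>A. a p * fst z p * f p x + (a p)\<^sup>2 * f p (snd z) * f p x - (a p)\<^sup>2 * (f p x)\<^sup>2 / 2)"
      for f :: "nat \<times> nat \<Rightarrow> config \<Rightarrow> real" and z :: "(nat \<times> nat \<Rightarrow> real) \<times> config" and x
    have Hm: "(\<lambda>(z, x). H f z x) \<in> borel_measurable ((\<Gamma> \<Otimes>\<^sub>M X) \<Otimes>\<^sub>M X)"
      if f: "\<And>p. p \<in> A \<Longrightarrow> f p \<in> borel_measurable X" for f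
      unfolding H_def case_prod_beta'
    proof (rule borel_measurable_sum)
      fix p assume p: "p \<in> A"
      note [measurable] = f[OF p]
      have [measurable]: "(\<lambda>z. fst (fst z) p) \<in> borel_measurable ((\<Gamma> \<Otimes>\<^sub>M X) \<Otimes>\<^sub>M X)"
        using measurable_compose[OF _ measurable_component_singleton[OF p, of "\<lambda>_. std_normal_distribution"],
          of "\<lambda>z. fst (fst z)" "(\<Gamma> \<Otimes>\<^sub>M X) \<Otimes>\<^sub>M X"] by (simp add: \<Gamma>_def)
      show "(\<lambda>z. a p * fst (fst z) p * f p (snd z) + (a p)\<^sup>2 * f p (snd (fst z)) * f p (snd z)
          - (a p)\<^sup>2 * (f p (snd z))\<^sup>2 / 2) \<in> borel_measurable ((\<Gamma> \<Otimes>\<^sub>M X) \<Otimes>\<^sub>M X)"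
        by measurable
    qed
    define L where "L f z = ln (\<integral>x. exp (H f z x) \<partial>X)" for f z
    have Lm: "L f \<in> borel_measurable (\<Gamma> \<Otimes>\<^sub>M X)" if f: "\<And>p. p \<in> A \<Longrightarrow> f p \<in> borel_measurable X" for f
    proof -
      note [measurable] = Hm[OF f]
      show ?thesis unfolding L_def by measurable
    qed
    have Hz: "H f z \<in> borel_measurable X" if "\<And>p. p \<in> A \<Longrightarrow> f p \<in> borel_measurable X" for f z
      unfolding H_def using that by (intro borel_measurable_sum) simp
    have Hw: "H w (W, x0) x = (\<Sum>p\<in>A. v x0 p (W p) x)" for W x0 x by (simp add: H_def v_def)
    have Hdom: "dominated_channel X (\<Gamma> \<Otimes>\<^sub>M X) (H w)"
    proof (rule dominated_channelI[OF \<Gamma>X.prob_space_axioms Hm[OF wm]])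
      show "integrable (\<Gamma> \<Otimes>\<^sub>M X) (\<lambda>z. \<Sum>p\<in>A. a p * c * ((1 + (fst z p)\<^sup>2) / 2) + 3 / 2 * (a p)\<^sup>2 * c\<^sup>2)"
      proof (rule integrable_pair_projections(1)[OF \<Gamma>.prob_space_axioms X.prob_space_axioms], unfold \<Gamma>_def,
          rule Bochner_Integration.integrable_sum, rule integrable_component_PiM[OF normal])
        interpret normal: prob_space std_normal_distribution by (rule normal)
        show "integrable std_normal_distribution (\<lambda>e. a p * c * ((1 + e\<^sup>2) / 2) + 3 / 2 * (a p)\<^sup>2 * c\<^sup>2)" for p
          using std_normal_moments(1)[of 2] by simp
      qed
      show "\<bar>H w z x\<bar> \<le> (\<Sum>p\<in>A. a p * c * ((1 + (fst z p)\<^sup>2) / 2) + 3 / 2 * (a p)\<^sup>2 * c\<^sup>2)"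
        if "x \<in> space X" for z x
      proof -
        have "H w z x = (\<Sum>p\<in>A. v (snd z) p (fst z p) x)" using Hw[of "fst z" "snd z" x] by simp
        also have "\<bar>\<dots>\<bar> \<le> (\<Sum>p\<in>A. \<bar>v (snd z) p (fst z p) x\<bar>)" by (rule sum_abs)
        also have "\<dots> \<le> (\<Sum>p\<in>A. a p * c * ((1 + (fst z p)\<^sup>2) / 2) + 3 / 2 * (a p)\<^sup>2 * c\<^sup>2)"
          by (intro sum_mono vbound that)
        finally show ?thesis .
      qed
    qed
    have Li: "integrable (\<Gamma> \<Otimes>\<^sub>M X) (case_prod (\<lambda>W x0. L w (W, x0)))"
      using X.log_partition_integrable[OF Hdom] by (simp add: L_def case_prod_beta')
    have GL: "G x0 = (\<integral>W. L w (W, x0) \<partial>\<Gamma>)" for x0 by (simp add: G_def L_def Hw)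
    show "integrable X G" unfolding GL by (rule \<Gamma>X.integrable_snd[OF Li])
    have Ho: "gauss_hamiltonian \<kappa> \<Delta> N W x0 x = H ov (W, x0) x" for W x0 x
      using N aI by (simp add: gauss_hamiltonian_overlap H_def A_def[symmetric] w_def ov_def a_def[symmetric])
    have AE2: "AE z in \<Gamma> \<Otimes>\<^sub>M X. \<forall>p\<in>A. w p (snd z) = ov p (snd z)"
    proof (rule \<Gamma>X.AE_pair_measure)
      have "{x \<in> space (\<Gamma> \<Otimes>\<^sub>M X). w p (snd x) = ov p (snd x)} \<in> sets (\<Gamma> \<Otimes>\<^sub>M X)" if p: "p \<in> A" for p
      proof -
        note [measurable] = om[OF p] wm[OF p]
        show ?thesis by measurable
      qed
      then show "{x \<in> space (\<Gamma> \<Otimes>\<^sub>M X). \<forall>p\<in>A. w p (snd x) = ov p (snd x)} \<in> sets (\<Gamma> \<Otimes>\<^sub>M X)"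
        using finA by (intro sets.sets_Collect_finite_All) auto
      show "AE W in \<Gamma>. AE x0 in X. \<forall>p\<in>A. w p (snd (W, x0)) = ov p (snd (W, x0))" using AEw by simp
    qed
    have "gauss_free_energy \<kappa> P0 \<Delta> N = 1 / real N * (\<integral>z. L ov z \<partial>(\<Gamma> \<Otimes>\<^sub>M X))"
      unfolding gauss_free_energy_def X_def[symmetric] A_def[symmetric] \<Gamma>_def[symmetric] Ho
      by (simp add: L_def case_prod_beta')
    also have "(\<integral>z. L ov z \<partial>(\<Gamma> \<Otimes>\<^sub>M X)) = (\<integral>z. L w z \<partial>(\<Gamma> \<Otimes>\<^sub>M X))"
    proof (rule integral_cong_AE[OF Lm[OF om] Lm[OF wm]])
      show "AE z in \<Gamma> \<Otimes>\<^sub>M X. L ov z = L w z"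
        using AE2
      proof eventually_elim
        case (elim z)
        \<comment> \<open>Two replacements at once: the overlap of \<open>x0\<close> by the choice
          of \<open>z\<close>, that of \<open>x\<close> almost surely under the inner
          integral.\<close>
        have "(\<integral>x. exp (H ov z x) \<partial>X) = (\<integral>x. exp (H w z x) \<partial>X)"
        proof (rule integral_cong_AE)
          show "AE x in X. exp (H ov z x) = exp (H w z x)"
            using AEw by eventually_elim (use elim in \<open>simp add: H_def\<close>)
        qed (use Hz[OF om] Hz[OF wm] in \<open>auto intro!: measurable_compose[OF _ borel_measurable_exp]\<close>)
        then show ?case by (simp add: L_def)
      qed
    qed
    also have "\<dots> = (\<integral>x0. G x0 \<partial>X)"
      using \<Gamma>X.integral_snd[OF Li] by (simp add: GL case_prod_beta')
    finally show "gauss_free_energy \<kappa> P0 \<Delta> N = 1 / real N * (\<integral>x0. G x0 \<partial>X)" .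
  qed
  have "\<bar>(\<integral>x0. F w x0 \<partial>X) - (\<integral>x0. G x0 \<partial>X)\<bar> \<le> real (card A) * \<epsilon>"
    by (rule integral_difference_bound[OF X.prob_space_axioms Fm[OF wm] Gi close])
  then have "1 / real N * \<bar>(\<integral>x0. F w x0 \<partial>X) - (\<integral>x0. G x0 \<partial>X)\<bar> \<le> 1 / real N * (real (card A) * \<epsilon>)"
    by (intro mult_left_mono) auto
  moreover have "\<bar>1 / real N * (\<integral>x0. F w x0 \<partial>X) - 1 / real N * (\<integral>x0. G x0 \<partial>X)\<bar>
      = 1 / real N * \<bar>(\<integral>x0. F w x0 \<partial>X) - (\<integral>x0. G x0 \<partial>X)\<bar>"
    by (simp add: right_diff_distrib[symmetric] diff_divide_distrib[symmetric])
  ultimately show ?thesis unfolding free gauss A_def \<epsilon>_def by simp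
qed

text \<open>Allows the derivative bound to be raised to at least 1, which lets the expansions absorb
  lower powers of it into higher ones.\<close>

lemma regular_llh_mono:
  assumes "regular_llh B \<mu> S g" "B \<le> B'"
  shows "regular_llh B' \<mu> S g"
  unfolding regular_llh_def
proof (intro allI impI ballI, clarify)
  fix N i j y assume *: "1 \<le> N" "(i, j) \<in> pairs N" "y \<in> space \<mu>"
  then obtain g1 g2 g3 where "\<forall>w\<in>S N. (g N i j y has_real_derivative g1 w) (at w within S N) \<and>
      (g1 has_real_derivative g2 w) (at w within S N) \<and>
      (g2 has_real_derivative g3 w) (at w within S N) \<and> \<bar>g3 w\<bar> \<le> B" "\<bar>g1 0\<bar> \<le> B" "\<bar>g2 0\<bar> \<le> B"
    using assms(1) unfolding regular_llh_def by fast
  then show "\<exists>g1 g2 g3. (\<forall>w\<in>S N. (g N i j y has_real_derivative g1 w) (at w within S N) \<and>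
      (g1 has_real_derivative g2 w) (at w within S N) \<and>
      (g2 has_real_derivative g3 w) (at w within S N) \<and> \<bar>g3 w\<bar> \<le> B') \<and> \<bar>g1 0\<bar> \<le> B' \<and> \<bar>g2 0\<bar> \<le> B'"
    using assms(2) by (intro exI[of _ g1] exI[of _ g2] exI[of _ g3]) (auto intro: order_trans)
qed

theorem theorem2p7:
  fixes C B :: real
  shows "\<exists>K. \<forall>\<kappa> P0 PX (\<mu> :: 'd measure) P g S \<Delta>.
           \<kappa> \<ge> 1 \<longrightarrow>
           spin_model \<kappa> P0 PX \<mu> P g \<longrightarrow>
           admissible_domain \<kappa> C S \<longrightarrow>
           bayes_optimal P0 PX \<mu> S P g \<longrightarrow>
           supported_in_cube \<kappa> C P0 \<longrightarrow>
           supported_in_cube \<kappa> C PX \<longrightarrow>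
           regular_llh B \<mu> S g \<longrightarrow>
           variance_profile P g \<Delta> \<longrightarrow>
           (\<forall>N\<ge>1. \<bar>free_energy \<kappa> P0 PX P g N - gauss_free_energy \<kappa> P0 \<Delta> N\<bar>
                    \<le> K * real \<kappa> ^ 3 * real N powr (- 1 / 2))"
proof -
  define B' where "B' = max 1 B"
  have "\<bar>free_energy \<kappa> P0 PX P g N - gauss_free_energy \<kappa> P0 \<Delta> N\<bar>
      \<le> 7040000 * B' ^ 12 * (C\<^sup>2) ^ 3 * real \<kappa> ^ 3 * real N powr (- 1 / 2)"
    if model: "spin_model \<kappa> P0 PX \<mu> P g" and dom: "admissible_domain \<kappa> C S"
      and bayes: "bayes_optimal P0 PX \<mu> S P g" and supp: "supported_in_cube \<kappa> C P0"
      and reg: "regular_llh B \<mu> S g" and var: "variance_profile P g \<Delta>" and N: "1 \<le> N"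
    for \<kappa> P0 PX P g S \<Delta> N and \<mu> :: "'d measure"
  proof -
    have PX: "PX = P0" using bayes by (simp add: bayes_optimal_def)
    define s where "s = sqrt (real N)"
    have s: "0 < s" "real N = s\<^sup>2" using N by (auto simp: s_def)
    define E where "E = 7040000 * B' ^ 12 * (C\<^sup>2) ^ 3 * real \<kappa> ^ 3"
    have E: "0 \<le> E" by (simp add: E_def B'_def)
    have eps: "7040000 * B' ^ 12 * (C\<^sup>2 * real \<kappa> / sqrt (real N)) ^ 3 = E / s ^ 3"
      by (simp add: E_def s_def power_divide power_mult_distrib)
    have "\<bar>free_energy \<kappa> P0 PX P g N - gauss_free_energy \<kappa> P0 \<Delta> N\<bar>
        \<le> 1 / real N * (real (card (pairs N)) * (E / s ^ 3))"
      using fixed_size_bound[OF model[unfolded PX] dom bayes[unfolded PX] supp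
        regular_llh_mono[OF reg, of B'] var _ N refl, unfolded eps] by (simp add: PX B'_def)
    also have "\<dots> \<le> 1 / real N * (real (N\<^sup>2) * (E / s ^ 3))"
      using E s card_pairs_le[of N] by (intro mult_left_mono mult_right_mono) (auto simp del: of_nat_power)
    \<comment> \<open>Prefactor, number of pairs and \<open>c ^ 3\<close> contribute
      \<open>s\<close> to the powers -2, 4 and -3.\<close>
    also have "\<dots> = E / s"
      using s by (simp add: power2_eq_square power3_eq_cube)
    also have "\<dots> = E * real N powr (- 1 / 2)"
      using N by (simp add: s_def powr_minus_divide powr_half_sqrt)
    finally show ?thesis by (simp add: E_def)
  qed
  \<comment> \<open>The witness depends on \<open>C\<close> and \<open>B\<close> alone, hence is
    uniform in \<open>\<kappa>\<close>, \<open>N\<close> and the model.\<close>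
  then show ?thesis by (intro exI[of _ "7040000 * B' ^ 12 * (C\<^sup>2) ^ 3"]) blast
qed

end
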